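(* Let $G,F,Q,\omega$ and the quasi-Hopf algebra $A^{\mathrm{op}}$ be as described in the context, and let $\chi$ be an irreducible character of $A^{\mathrm{op}}$. Then the Frobenius-Schur indicator of $\chi$ is given by $$\chi(\nu_{A^{\mathrm{op}}})=|F|^{-1}\sum_{(q\triangleleft x).q=e}\omega(xq,xq,xq)\ \chi(\delta_q(xq)^2)$$ $$=|F|^{-1}\sum_{(q\triangleleft x).q=e}\tau_x(q\triangleleft x,q)\,\sigma_q(x,q\triangleright x)\,\omega((q\triangleleft x)^L,q\triangleleft x,q)\,\sigma_q\bigl(x(q\triangleright x),(q\triangleleft x)q\bigr)\ \chi(\delta_q(xq)^2),$$ where both sums run over all pairs $(q,x)\in Q\times F$ with $(q\triangleleft x).q=e$ (for such pairs $(xq)^2\in F$ and $(q\triangleleft x)q\in F$).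
   Context: Setting. $k$ is an algebraically closed field of characteristic zero; $G$ is a finite group with identity $e$; $F\subseteq G$ is a subgroup; $Q\subseteq G$ with $e\in Q$ is simultaneously a set of representatives of the cosets $Fg$ and of the cosets $gF$, so every $g\in G$ factors uniquely as $g=xq$ and uniquely as $g=py$ with $x,y\in F$, $p,q\in Q$. Define $\triangleright:Q\times F\to F$, $\triangleleft:Q\times F\to Q$, $.:Q\times Q\to Q$, $\theta:Q\times Q\to F$ by $qx=(q\triangleright x)(q\triangleleft x)$ and $pq=\theta(p,q)\,(p.q)$ for $p,q\in Q$, $x\in F$. For every $p\in Q$ there are unique $p^L,p^R\in Q$ with $p^L.p=e=p.p^R$. Put $p\succ x=\theta(p,p^R)^{-1}\,(p\triangleright x)\,\theta(p\triangleleft x,(p\triangleleft x)^R)\in F$. $\omega:G\times G\times G\to k^\times$ is a normalized 3-cocycle, i.e. $\omega(ab,c,d)\omega(a,b,cd)=\omega(a,b,c)\omega(a,bc,d)\omega(b,c,d)$ and $\omega(e,a,b)=\omega(a,e,b)=\omega(a,b,e)=1$, satisfying $\omega|_{F\times G\times G}=1$ and $\omega|_{G\times F\times Q}=1$. Put $\sigma_p(x,y)=\omega(p,x,y)$ and $\tau_x(p,q)=\omega(p,q,x)$ for $p,q\in Q$, $x,y\in F$. $A=k^Q\#_\sigma kF$ is the vector space $k^Q\otimes kF$ with basis $\delta_px:=\delta_p\otimes x$ ($p\in Q$, $x\in F$), multiplication $(\delta_px).(\delta_qy)=\delta_{p\triangleleft x,\,q}\,\sigma_p(x,y)\,\delta_p\,xy$,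 unit $\sum_{p\in Q}\delta_pe$, comultiplication $\Delta(\delta_px)=\sum_{s.t=p}\tau_x(s,t)\,\delta_s(t\triangleright x)\otimes\delta_tx$ and counit $\epsilon(\delta_px)=\delta_{p,e}$. $A^{\mathrm{op}}$ is $A$ with the opposite multiplication $a\circ b=b.a$ and the same $\Delta,\epsilon$. It is a semisimple quasi-Hopf algebra with associator $\Phi=\sum_{p,q,r\in Q}\omega(p,q,r)\,\delta_p\theta(q,r)\otimes\delta_qe\otimes\delta_re$, quasi-antipode $\mathcal S(\delta_px)=\tau_{p\succ x}(p,p^R)^{-1}\sigma_{p^R}(p\succ x,(p\succ x)^{-1})^{-1}\,\delta_{(p\triangleleft x)^R}(p\succ x)^{-1}$, $\alpha=1$ and $\beta=\sum_{q\in Q}\omega(q^{-1},q,q^{-1})\,\delta_q\theta(q^L,q)^{-1}$. Frobenius-Schur indicator. For a finite dimensional semisimple quasi-Hopf algebra $(H,\Delta,\epsilon,\Phi,\mathcal S,\alpha,\beta)$ let $\Lambda\in H$ be the unique normalized two-sided integral: $h\Lambda=\epsilon(h)\Lambda=\Lambda h$ for all $h$, $\epsilon(\Lambda)=1$. Write $\Phi=\Phi^{(1)}\otimes\Phi^{(2)}\otimes\Phi^{(3)}$, $\Phi^{-1}=\Phi^{(-1)}\otimes\Phi^{(-2)}\otimes\Phi^{(-3)}$, $q_L=\mathcal S(\Phi^{(-1)})\alpha\Phi^{(-2)}\otimes\Phi^{(-3)}$ and $p_L=\Phi^{(2)}\mathcal S^{-1}(\Phi^{(1)}\beta)\otimes\Phi^{(3)}$.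 Put $\nu_H=m(q_L\Delta(\Lambda)p_L)$, $m:H\otimes H\to H$ being the multiplication. The Frobenius-Schur indicator of an irreducible character $\chi$ of $H$ is $\chi(\nu_H)$. For $H=A^{\mathrm{op}}$ all products are taken with respect to $\circ$. *)

theory Defs
  imports
    "HOL-Analysis.Determinants"
    "HOL-Algebra.Left_Coset"
    "HOL-Computational_Algebra.Polynomial"
begin

section \<open>Vectors in coordinates\<close>

text \<open>
  A finite-dimensional vector space with a chosen basis \<open>B\<close> is represented by the coefficient
  functions that vanish outside \<open>B\<close>; the tensor product of two such spaces consists of
  the coefficient functions on the product of the bases.
\<close>

definition basis_vec :: "'b \<Rightarrow> 'b \<Rightarrow> 'k::field" where
  "basis_vec b = (\<lambda>c. if c = b then 1 else 0)"

definition scal :: "'k::field \<Rightarrow> ('b \<Rightarrow> 'k) \<Rightarrow> 'b \<Rightarrow> 'k" where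
  "scal c u = (\<lambda>b. c * u b)"

definition lincomb :: "'i set \<Rightarrow> ('i \<Rightarrow> 'k::field) \<Rightarrow> ('i \<Rightarrow> 'b \<Rightarrow> 'k) \<Rightarrow> 'b \<Rightarrow> 'k" where
  "lincomb I c v = (\<lambda>b. \<Sum>i\<in>I. c i * v i b)"

definition tens :: "('a \<Rightarrow> 'k::field) \<Rightarrow> ('b \<Rightarrow> 'k) \<Rightarrow> 'a \<times> 'b \<Rightarrow> 'k" where
  "tens u v = (\<lambda>(a, b). u a * v b)"


section \<open>Algebras and quasi-Hopf algebras given by structure constants\<close>

text \<open>\<open>bmul H a b\<close> is the product of the basis elements \<open>a\<close> and \<open>b\<close>, as a vector.\<close>

record ('b, 'k) based_algebra =
  bas :: "'b set"
  bmul :: "'b \<Rightarrow> 'b \<Rightarrow> 'b \<Rightarrow> 'k"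
  bunit :: "'b \<Rightarrow> 'k"

definition elems :: "('b, 'k::field, 'm) based_algebra_scheme \<Rightarrow> ('b \<Rightarrow> 'k) set" where
  "elems H = {u. \<forall>b. b \<notin> bas H \<longrightarrow> u b = 0}"

definition amul :: "('b, 'k::field, 'm) based_algebra_scheme \<Rightarrow> ('b \<Rightarrow> 'k) \<Rightarrow> ('b \<Rightarrow> 'k) \<Rightarrow> 'b \<Rightarrow> 'k"
  where "amul H u v = lincomb (bas H \<times> bas H) (\<lambda>(a, b). u a * v b) (\<lambda>(a, b). bmul H a b)"

definition op_algebra :: "('b, 'k::field) based_algebra \<Rightarrow> ('b, 'k) based_algebra" where
  "op_algebra H = \<lparr>bas = bas H, bmul = (\<lambda>a b. bmul H b a), bunit = bunit H\<rparr>"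

definition tensor_algebra ::
  "('a, 'k::field, 'm) based_algebra_scheme \<Rightarrow> ('b, 'k, 'n) based_algebra_scheme
    \<Rightarrow> ('a \<times> 'b, 'k) based_algebra" where
  "tensor_algebra H K =
    \<lparr>bas = bas H \<times> bas K,
     bmul = (\<lambda>(a, b) (a', b'). tens (bmul H a a') (bmul K b b')),
     bunit = tens (bunit H) (bunit K)\<rparr>"

definition algebra_inverse :: "('b, 'k::field, 'm) based_algebra_scheme \<Rightarrow> ('b \<Rightarrow> 'k) \<Rightarrow> 'b \<Rightarrow> 'k"
  where "algebra_inverse H u =
    (THE v. v \<in> elems H \<and> amul H u v = bunit H \<and> amul H v u = bunit H)"

text \<open>
  The comultiplication, counit and antipode are stored by their values on the basis
  and extended linearly by \<open>Delta\<close>, \<open>eps\<close> and \<open>antip\<close>.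
  The record carries the data only, not the axioms.
\<close>

record ('b, 'k) quasi_hopf = "('b, 'k) based_algebra" +
  bcomult :: "'b \<Rightarrow> 'b \<times> 'b \<Rightarrow> 'k"
  bcounit :: "'b \<Rightarrow> 'k"
  associator :: "'b \<times> 'b \<times> 'b \<Rightarrow> 'k"
  bantipode :: "'b \<Rightarrow> 'b \<Rightarrow> 'k"
  alpha :: "'b \<Rightarrow> 'k"
  beta :: "'b \<Rightarrow> 'k"

definition Delta :: "('b, 'k::field) quasi_hopf \<Rightarrow> ('b \<Rightarrow> 'k) \<Rightarrow> 'b \<times> 'b \<Rightarrow> 'k" where
  "Delta H u = lincomb (bas H) u (bcomult H)"

definition eps :: "('b, 'k::field) quasi_hopf \<Rightarrow> ('b \<Rightarrow> 'k) \<Rightarrow> 'k" where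
  "eps H u = (\<Sum>b\<in>bas H. u b * bcounit H b)"

definition antip :: "('b, 'k::field) quasi_hopf \<Rightarrow> ('b \<Rightarrow> 'k) \<Rightarrow> 'b \<Rightarrow> 'k" where
  "antip H u = lincomb (bas H) u (bantipode H)"

definition antip_inv :: "('b, 'k::field) quasi_hopf \<Rightarrow> ('b \<Rightarrow> 'k) \<Rightarrow> 'b \<Rightarrow> 'k" where
  "antip_inv H = inv_into (elems H) (antip H)"


section \<open>Frobenius--Schur indicators\<close>

definition norm_integral :: "('b, 'k::field) quasi_hopf \<Rightarrow> 'b \<Rightarrow> 'k" where
  "norm_integral H = (THE L. L \<in> elems H \<and> eps H L = 1 \<and>
     (\<forall>h\<in>elems H. amul H h L = scal (eps H h) L \<and> amul H L h = scal (eps H h) L))"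

definition associator_inv :: "('b, 'k::field) quasi_hopf \<Rightarrow> 'b \<times> 'b \<times> 'b \<Rightarrow> 'k" where
  "associator_inv H = algebra_inverse (tensor_algebra H (tensor_algebra H H)) (associator H)"

text \<open>
  In \<open>q_L\<close> and \<open>p_L\<close> the formal tensors \<open>\<Phi>\<close> and \<open>\<Phi>\<^sup>-\<^sup>1\<close> are expanded in the product
  basis of \<open>H \<otimes> H \<otimes> H\<close>.
\<close>

definition q_L :: "('b, 'k::field) quasi_hopf \<Rightarrow> 'b \<times> 'b \<Rightarrow> 'k" where
  "q_L H = lincomb (bas H \<times> bas H \<times> bas H) (associator_inv H)
     (\<lambda>(a, b, c). tens (amul H (amul H (antip H (basis_vec a)) (alpha H)) (basis_vec b)) (basis_vec c))"

definition p_L :: "('b, 'k::field) quasi_hopf \<Rightarrow> 'b \<times> 'b \<Rightarrow> 'k" where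
  "p_L H = lincomb (bas H \<times> bas H \<times> bas H) (associator H)
     (\<lambda>(a, b, c). tens (amul H (basis_vec b) (antip_inv H (amul H (basis_vec a) (beta H)))) (basis_vec c))"

definition mult_map :: "('b, 'k::field) quasi_hopf \<Rightarrow> ('b \<times> 'b \<Rightarrow> 'k) \<Rightarrow> 'b \<Rightarrow> 'k" where
  "mult_map H t = lincomb (bas H \<times> bas H) t (\<lambda>(a, b). bmul H a b)"

definition nu :: "('b, 'k::field) quasi_hopf \<Rightarrow> 'b \<Rightarrow> 'k" where
  "nu H = mult_map H
     (amul (tensor_algebra H H) (amul (tensor_algebra H H) (q_L H) (Delta H (norm_integral H))) (p_L H))"

definition FS_indicator :: "('b, 'k::field) quasi_hopf \<Rightarrow> (('b \<Rightarrow> 'k) \<Rightarrow> 'k) \<Rightarrow> 'k" where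
  "FS_indicator H ch = ch (nu H)"


section \<open>Irreducible characters\<close>

text \<open>
  Representations are matrix representations on \<open>'k ^ 'n\<close>, whose dimension \<open>CARD('n)\<close> is
  automatically positive; their values outside \<open>elems H\<close> are irrelevant.
\<close>

definition representation ::
  "('b, 'k::field, 'm) based_algebra_scheme \<Rightarrow> (('b \<Rightarrow> 'k) \<Rightarrow> 'k ^ 'n::finite ^ 'n) \<Rightarrow> bool" where
  "representation H \<rho> \<longleftrightarrow>
     (\<forall>u\<in>elems H. \<forall>v\<in>elems H. \<rho> (\<lambda>b. u b + v b) = \<rho> u + \<rho> v) \<and>
     (\<forall>c. \<forall>u\<in>elems H. \<forall>i j. \<rho> (scal c u) $ i $ j = c * \<rho> u $ i $ j) \<and>
     (\<forall>u\<in>elems H. \<forall>v\<in>elems H. \<rho> (amul H u v) = \<rho> u ** \<rho> v) \<and>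
     \<rho> (bunit H) = mat 1"

definition irreducible_representation ::
  "('b, 'k::field, 'm) based_algebra_scheme \<Rightarrow> (('b \<Rightarrow> 'k) \<Rightarrow> 'k ^ 'n::finite ^ 'n) \<Rightarrow> bool" where
  "irreducible_representation H \<rho> \<longleftrightarrow> representation H \<rho> \<and>
     (\<forall>W. vec.subspace W \<and> (\<forall>u\<in>elems H. \<forall>w\<in>W. \<rho> u *v w \<in> W) \<longrightarrow> W = {0} \<or> W = UNIV)"

definition character :: "(('b \<Rightarrow> 'k::field) \<Rightarrow> 'k ^ 'n::finite ^ 'n) \<Rightarrow> ('b \<Rightarrow> 'k) \<Rightarrow> 'k" where
  "character \<rho> u = trace (\<rho> u)"


section \<open>Coset representatives and the associated operations\<close>

definition two_sided_transversal :: "('g, 'm) monoid_scheme \<Rightarrow> 'g set \<Rightarrow> 'g set \<Rightarrow> bool" where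
  "two_sided_transversal G F Q \<longleftrightarrow> Q \<subseteq> carrier G \<and>
     (\<forall>C\<in>rcosets\<^bsub>G\<^esub> F. \<exists>!q. q \<in> Q \<inter> C) \<and> (\<forall>C\<in>lcosets\<^bsub>G\<^esub> F. \<exists>!q. q \<in> Q \<inter> C)"

text \<open>The components of the factorization \<open>g = x q\<close> with \<open>x \<in> F\<close> and \<open>q \<in> Q\<close>:\<close>

definition F_part :: "('g, 'm) monoid_scheme \<Rightarrow> 'g set \<Rightarrow> 'g set \<Rightarrow> 'g \<Rightarrow> 'g" where
  "F_part G F Q g = (THE x. x \<in> F \<and> (\<exists>q\<in>Q. g = x \<otimes>\<^bsub>G\<^esub> q))"

definition Q_part :: "('g, 'm) monoid_scheme \<Rightarrow> 'g set \<Rightarrow> 'g set \<Rightarrow> 'g \<Rightarrow> 'g" where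
  "Q_part G F Q g = (THE q. q \<in> Q \<and> (\<exists>x\<in>F. g = x \<otimes>\<^bsub>G\<^esub> q))"

text \<open>
  \<open>q \<triangleright> x\<close> is \<open>rhd G F Q q x\<close>, \<open>q \<triangleleft> x\<close> is \<open>lhd G F Q q x\<close>,
  \<open>\<theta>(p, q)\<close> is \<open>theta G F Q p q\<close> and \<open>p.q\<close> is \<open>dot G F Q p q\<close>.
\<close>

definition rhd :: "('g, 'm) monoid_scheme \<Rightarrow> 'g set \<Rightarrow> 'g set \<Rightarrow> 'g \<Rightarrow> 'g \<Rightarrow> 'g" where
  "rhd G F Q q x = F_part G F Q (q \<otimes>\<^bsub>G\<^esub> x)"

definition lhd :: "('g, 'm) monoid_scheme \<Rightarrow> 'g set \<Rightarrow> 'g set \<Rightarrow> 'g \<Rightarrow> 'g \<Rightarrow> 'g" where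
  "lhd G F Q q x = Q_part G F Q (q \<otimes>\<^bsub>G\<^esub> x)"

definition theta :: "('g, 'm) monoid_scheme \<Rightarrow> 'g set \<Rightarrow> 'g set \<Rightarrow> 'g \<Rightarrow> 'g \<Rightarrow> 'g" where
  "theta G F Q p q = F_part G F Q (p \<otimes>\<^bsub>G\<^esub> q)"

definition dot :: "('g, 'm) monoid_scheme \<Rightarrow> 'g set \<Rightarrow> 'g set \<Rightarrow> 'g \<Rightarrow> 'g \<Rightarrow> 'g" where
  "dot G F Q p q = Q_part G F Q (p \<otimes>\<^bsub>G\<^esub> q)"

definition linv :: "('g, 'm) monoid_scheme \<Rightarrow> 'g set \<Rightarrow> 'g set \<Rightarrow> 'g \<Rightarrow> 'g" where
  "linv G F Q p = (THE l. l \<in> Q \<and> dot G F Q l p = \<one>\<^bsub>G\<^esub>)"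

definition rinv :: "('g, 'm) monoid_scheme \<Rightarrow> 'g set \<Rightarrow> 'g set \<Rightarrow> 'g \<Rightarrow> 'g" where
  "rinv G F Q p = (THE r. r \<in> Q \<and> dot G F Q p r = \<one>\<^bsub>G\<^esub>)"

text \<open>The operation written \<open>p \<succ> x\<close>:\<close>

definition succ_act :: "('g, 'm) monoid_scheme \<Rightarrow> 'g set \<Rightarrow> 'g set \<Rightarrow> 'g \<Rightarrow> 'g \<Rightarrow> 'g" where
  "succ_act G F Q p x =
     inv\<^bsub>G\<^esub> (theta G F Q p (rinv G F Q p)) \<otimes>\<^bsub>G\<^esub> rhd G F Q p x
       \<otimes>\<^bsub>G\<^esub> theta G F Q (lhd G F Q p x) (rinv G F Q (lhd G F Q p x))"


section \<open>The cocycle and the quasi-Hopf algebra\<close>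

definition normalized_3_cocycle ::
  "('g, 'm) monoid_scheme \<Rightarrow> ('g \<Rightarrow> 'g \<Rightarrow> 'g \<Rightarrow> 'k::field) \<Rightarrow> bool" where
  "normalized_3_cocycle G \<omega> \<longleftrightarrow>
     (\<forall>a\<in>carrier G. \<forall>b\<in>carrier G. \<forall>c\<in>carrier G. \<omega> a b c \<noteq> 0) \<and>
     (\<forall>a\<in>carrier G. \<forall>b\<in>carrier G. \<forall>c\<in>carrier G. \<forall>d\<in>carrier G.
        \<omega> (a \<otimes>\<^bsub>G\<^esub> b) c d * \<omega> a b (c \<otimes>\<^bsub>G\<^esub> d) = \<omega> a b c * \<omega> a (b \<otimes>\<^bsub>G\<^esub> c) d * \<omega> b c d) \<and>
     (\<forall>a\<in>carrier G. \<forall>b\<in>carrier G.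
        \<omega> \<one>\<^bsub>G\<^esub> a b = 1 \<and> \<omega> a \<one>\<^bsub>G\<^esub> b = 1 \<and> \<omega> a b \<one>\<^bsub>G\<^esub> = 1)"

definition sigma_coc :: "('g \<Rightarrow> 'g \<Rightarrow> 'g \<Rightarrow> 'k) \<Rightarrow> 'g \<Rightarrow> 'g \<Rightarrow> 'g \<Rightarrow> 'k" where
  "sigma_coc \<omega> p x y = \<omega> p x y"

definition tau_coc :: "('g \<Rightarrow> 'g \<Rightarrow> 'g \<Rightarrow> 'k) \<Rightarrow> 'g \<Rightarrow> 'g \<Rightarrow> 'g \<Rightarrow> 'k" where
  "tau_coc \<omega> x p q = \<omega> p q x"

text \<open>The basis element \<open>\<delta>\<^sub>p x\<close> of \<open>A\<close> is \<open>basis_vec (p, x)\<close>.\<close>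

definition algA ::
  "('g, 'm) monoid_scheme \<Rightarrow> 'g set \<Rightarrow> 'g set \<Rightarrow> ('g \<Rightarrow> 'g \<Rightarrow> 'g \<Rightarrow> 'k::field)
    \<Rightarrow> ('g \<times> 'g, 'k) based_algebra" where
  "algA G F Q \<omega> =
    \<lparr>bas = Q \<times> F,
     bmul = (\<lambda>(p, x) (q, y). scal (if lhd G F Q p x = q then sigma_coc \<omega> p x y else 0)
                                  (basis_vec (p, x \<otimes>\<^bsub>G\<^esub> y))),
     bunit = lincomb Q (\<lambda>p. 1) (\<lambda>p. basis_vec (p, \<one>\<^bsub>G\<^esub>))\<rparr>"

definition Aop ::
  "('g, 'm) monoid_scheme \<Rightarrow> 'g set \<Rightarrow> 'g set \<Rightarrow> ('g \<Rightarrow> 'g \<Rightarrow> 'g \<Rightarrow> 'k::field)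
    \<Rightarrow> ('g \<times> 'g, 'k) quasi_hopf" where
  "Aop G F Q \<omega> =
    \<lparr>bas = bas (op_algebra (algA G F Q \<omega>)),
     bmul = bmul (op_algebra (algA G F Q \<omega>)),
     bunit = bunit (op_algebra (algA G F Q \<omega>)),
     bcomult = (\<lambda>(p, x). lincomb {(s, t). s \<in> Q \<and> t \<in> Q \<and> dot G F Q s t = p}
        (\<lambda>(s, t). tau_coc \<omega> x s t)
        (\<lambda>(s, t). tens (basis_vec (s, rhd G F Q t x)) (basis_vec (t, x)))),
     bcounit = (\<lambda>(p, x). if p = \<one>\<^bsub>G\<^esub> then 1 else 0),
     associator = lincomb (Q \<times> Q \<times> Q) (\<lambda>(p, q, r). \<omega> p q r)
        (\<lambda>(p, q, r). tens (basis_vec (p, theta G F Q q r))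
                       (tens (basis_vec (q, \<one>\<^bsub>G\<^esub>)) (basis_vec (r, \<one>\<^bsub>G\<^esub>)))),
     bantipode = (\<lambda>(p, x). scal
        (inverse (tau_coc \<omega> (succ_act G F Q p x) p (rinv G F Q p))
          * inverse (sigma_coc \<omega> (rinv G F Q p) (succ_act G F Q p x) (inv\<^bsub>G\<^esub> (succ_act G F Q p x))))
        (basis_vec (rinv G F Q (lhd G F Q p x), inv\<^bsub>G\<^esub> (succ_act G F Q p x)))),
     alpha = bunit (algA G F Q \<omega>),
     beta = lincomb Q (\<lambda>q. \<omega> (inv\<^bsub>G\<^esub> q) q (inv\<^bsub>G\<^esub> q))
        (\<lambda>q. basis_vec (q, inv\<^bsub>G\<^esub> (theta G F Q (linv G F Q q) q)))\<rparr>"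

end

theory Submission
  imports Defs
begin

text \<open>
  All structure maps of \<open>A\<^sup>o\<^sup>p\<close> are monomial in the basis \<open>\<delta>\<^sub>p x\<close>, so \<open>\<nu>\<close> can be computed
  outright: with \<open>\<Lambda> = |F|\<^sup>-\<^sup>1 \<Sum>\<^sub>x \<delta>\<^sub>e x\<close>, the triple product defining \<open>\<nu>\<close> pairs
  \<open>\<delta>\<^sub>s (t \<triangleright> x) \<otimes> \<delta>\<^sub>t x\<close>, where \<open>s = t\<^sup>L\<close>, with one term of \<open>q\<^sub>L\<close> and one term of \<open>p\<^sub>L\<close>, and the final
  multiplication keeps only the terms with \<open>t \<triangleleft> x = t\<^sup>L\<close>, which land on \<open>\<delta>\<^sub>t (x t)\<^sup>2\<close>. The scalars from
  the antipode, \<open>\<beta>\<close> and \<open>\<Phi>\<^sup>-\<^sup>1\<close> cancel up to \<open>\<omega>(t\<^sup>L\<^sup>L, t\<^sup>L, t)\<close>. The passage to \<open>\<omega>(xq, xq, xq)\<close> and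
  the cancellation use only the cocycle identity and the triviality of \<open>\<omega>\<close> on \<open>F \<times> G \<times> G\<close> and
  \<open>G \<times> F \<times> Q\<close>. The formula thus holds for \<open>\<nu>\<close> itself, before any character is applied.
\<close>

section \<open>Monomial linear algebra in coordinates\<close>

lemma lincomb_cong:
  "I = J \<Longrightarrow> (\<And>i. i \<in> J \<Longrightarrow> c i = d i) \<Longrightarrow> (\<And>i. i \<in> J \<Longrightarrow> v i = w i) \<Longrightarrow> lincomb I c v = lincomb J d w"
  by (auto simp: lincomb_def intro!: ext sum.cong)

lemma lincomb_cong_scal:
  "(\<And>i. i \<in> I \<Longrightarrow> scal (c i) (v i) = scal (d i) (w i)) \<Longrightarrow> lincomb I c v = lincomb I d w"
  by (auto simp: lincomb_def scal_def fun_eq_iff intro!: sum.cong)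

lemma lincomb_scal: "lincomb I c (\<lambda>i. scal (k i) (v i)) = lincomb I (\<lambda>i. c i * k i) v"
  by (simp add: lincomb_def scal_def mult.assoc)

lemma scal_lincomb: "scal k (lincomb I c v) = lincomb I (\<lambda>i. k * c i) v"
  by (simp add: lincomb_def scal_def sum_distrib_left mult.assoc)

lemma scal_scal [simp]: "scal a (scal b v) = scal (a * b) v"
  by (simp add: scal_def mult.assoc)

lemma scal_one [simp]: "scal 1 v = v"
  by (simp add: scal_def)

lemma tens_scal: "tens (scal a u) (scal b v) = scal (a * b) (tens u v)"
  by (auto simp: tens_def scal_def)

lemma tens_scal_left: "tens (scal a u) v = scal a (tens u v)"
  by (auto simp: tens_def scal_def)

lemma tens_basis_vec: "tens (basis_vec a) (basis_vec b) = basis_vec (a, b)"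
  by (auto simp: tens_def basis_vec_def)

text \<open>The main device for collapsing sums that carry Kronecker deltas: \<open>f\<close>
  parametrizes a set of indices outside which the coefficients vanish.\<close>

lemma lincomb_restrict:
  assumes "finite I" "inj_on f J" "\<And>j. j \<in> J \<Longrightarrow> f j \<in> I"
    and "\<And>i. i \<in> I \<Longrightarrow> i \<notin> f ` J \<Longrightarrow> c i = 0"
    and "\<And>j. j \<in> J \<Longrightarrow> c (f j) = d j"
    and "\<And>j. j \<in> J \<Longrightarrow> v (f j) = w j"
  shows "lincomb I c v = lincomb J d w"
proof
  fix b
  have "(\<Sum>i\<in>I. c i * v i b) = (\<Sum>i\<in>f ` J. c i * v i b)"
    using assms by (intro sum.mono_neutral_right) auto
  also have "\<dots> = (\<Sum>j\<in>J. d j * w j b)"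
    using assms by (simp add: sum.reindex)
  finally show "lincomb I c v b = lincomb J d w b"
    by (simp add: lincomb_def)
qed

lemma lincomb_lincomb:
  "lincomb I c (\<lambda>i. lincomb J (d i) (v i)) = lincomb (I \<times> J) (\<lambda>(i, j). c i * d i j) (\<lambda>(i, j). v i j)"
  by (auto simp: lincomb_def sum_distrib_left sum.cartesian_product mult.assoc intro!: ext sum.cong)

lemma tens_lincomb:
  "tens (lincomb I c u) (lincomb J d v) =
     lincomb (I \<times> J) (\<lambda>(i, j). c i * d j) (\<lambda>(i, j). tens (u i) (v j))"
  by (auto simp: lincomb_def tens_def sum_product sum.cartesian_product mult_ac intro!: ext sum.cong)

lemma lincomb_linear:
  "lincomb B (lincomb I c u) g = lincomb I c (\<lambda>i. lincomb B (u i) g)"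
proof
  fix b
  have "(\<Sum>a\<in>B. (\<Sum>i\<in>I. c i * u i a) * g a b) = (\<Sum>a\<in>B. \<Sum>i\<in>I. c i * (u i a * g a b))"
    by (simp add: sum_distrib_right mult.assoc)
  also have "\<dots> = (\<Sum>i\<in>I. \<Sum>a\<in>B. c i * (u i a * g a b))"
    by (rule sum.swap)
  finally show "lincomb B (lincomb I c u) g b = lincomb I c (\<lambda>i. lincomb B (u i) g) b"
    by (simp add: lincomb_def sum_distrib_left)
qed

lemma lincomb_basis_vec:
  "finite B \<Longrightarrow> a \<in> B \<Longrightarrow> lincomb B (basis_vec a) g = g a"
  by (auto simp: lincomb_def basis_vec_def if_distrib[of "\<lambda>x. x * _"] sum.delta cong: if_cong)

lemma lincomb_scal_left: "lincomb B (scal k u) g = scal k (lincomb B u g)"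
  by (simp add: lincomb_def scal_def sum_distrib_left mult.assoc)

lemma lincomb_expand:
  assumes "finite (bas H)" "u \<in> elems H"
  shows "u = lincomb (bas H) u basis_vec"
proof
  fix b
  have "(\<Sum>i\<in>bas H. u i * basis_vec i b) = (\<Sum>i\<in>bas H. if i = b then u i else 0)"
    by (intro sum.cong) (auto simp: basis_vec_def)
  then show "u b = lincomb (bas H) u basis_vec b"
    using assms by (auto simp: lincomb_def elems_def)
qed

lemma elems_zero: "u \<in> elems H \<Longrightarrow> b \<notin> bas H \<Longrightarrow> u b = 0"
  by (simp add: elems_def)

lemma basis_vec_elems: "a \<in> bas H \<Longrightarrow> basis_vec a \<in> elems H"
  by (auto simp: elems_def basis_vec_def)

lemma lincomb_elems: "(\<And>i. i \<in> I \<Longrightarrow> v i \<in> elems H) \<Longrightarrow> lincomb I c v \<in> elems H"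
  by (auto simp: elems_def lincomb_def intro!: sum.neutral)

lemma scal_elems: "v \<in> elems H \<Longrightarrow> scal c v \<in> elems H"
  by (auto simp: elems_def scal_def)

text \<open>At the coordinate \<open>h b\<close> only the summand with index \<open>b\<close>
  contributes, since \<open>h\<close> is injective. This is injectivity of a monomial map, applied
  later to the antipode and to right multiplication by the associator.\<close>

lemma monomial_map_cancel:
  fixes u v k :: "'b \<Rightarrow> 'k::field"
  assumes "finite B" "inj_on h B" "\<And>b. b \<in> B \<Longrightarrow> k b \<noteq> 0"
    and eq: "lincomb B (\<lambda>b. u b * k b) (\<lambda>b. basis_vec (h b)) =
      lincomb B (\<lambda>b. v b * k b) (\<lambda>b. basis_vec (h b))"
    and "b \<in> B"
  shows "u b = v b"
proof -
  have at: "lincomb B (\<lambda>b. u b * k b) (\<lambda>b. basis_vec (h b)) (h b) = u b * k b" for u :: "'b \<Rightarrow> 'k"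
  proof -
    have "lincomb B (\<lambda>b. u b * k b) (\<lambda>b. basis_vec (h b)) (h b) =
        (\<Sum>i\<in>B. if i = b then u i * k i else 0)"
      unfolding lincomb_def using assms(2,5)
      by (intro sum.cong) (auto simp: basis_vec_def dest: inj_onD)
    then show ?thesis using assms by simp
  qed
  show ?thesis
    using at[of u] at[of v] eq assms by simp
qed

section \<open>Bilinearity of products and tensor products of algebras\<close>

lemma amul_tens_form: "amul H u v = lincomb (bas H \<times> bas H) (tens u v) (\<lambda>(a, b). bmul H a b)"
  by (simp add: amul_def tens_def)

lemma amul_lincomb:
  "amul H (lincomb I c u) (lincomb J d v) =
     lincomb (I \<times> J) (\<lambda>(i, j). c i * d j) (\<lambda>(i, j). amul H (u i) (v j))"
  unfolding amul_tens_form tens_lincomb lincomb_linear by (intro lincomb_cong) auto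

text \<open>A vector seen as a one-term combination, so that linearity in a single argument follows
  from the bilinear rule \<open>amul_lincomb\<close>.\<close>

lemma lincomb_singleton: "lincomb {()} (\<lambda>_. 1) (\<lambda>_. v) = v"
  by (simp add: lincomb_def)

lemma amul_lincomb_right:
  "amul H u (lincomb J d v) = lincomb J d (\<lambda>j. amul H u (v j))"
proof -
  have "amul H u (lincomb J d v) =
      lincomb ({()} \<times> J) (\<lambda>(i, j). 1 * d j) (\<lambda>(i, j). amul H u (v j))"
    using amul_lincomb[of H "{()}" "\<lambda>_. 1" "\<lambda>_. u" J d v] by (simp add: lincomb_singleton)
  also have "\<dots> = lincomb J d (\<lambda>j. amul H u (v j))"
    unfolding lincomb_def by (simp add: sum.cartesian_product')
  finally show ?thesis .
qed

lemma amul_scal: "amul H (scal a u) (scal b v) = scal (a * b) (amul H u v)"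
  by (auto simp: amul_def lincomb_def scal_def sum_distrib_left mult_ac intro!: ext sum.cong)

lemma amul_scal_left: "amul H (scal a u) v = scal a (amul H u v)"
  using amul_scal[of H a u 1 v] by simp

lemma amul_scal_right: "amul H u (scal b v) = scal b (amul H u v)"
  using amul_scal[of H 1 u b v] by simp

lemma amul_basis:
  "finite (bas H) \<Longrightarrow> a \<in> bas H \<Longrightarrow> b \<in> bas H \<Longrightarrow> amul H (basis_vec a) (basis_vec b) = bmul H a b"
  by (simp add: amul_tens_form tens_basis_vec lincomb_basis_vec)

text \<open>After the two middle summations are interchanged, the fourfold sum splits into a product
  of two double sums, one for each tensor factor.\<close>

lemma amul_tens:
  "amul (tensor_algebra H K) (tens u v) (tens u' v') = tens (amul H u u') (amul K v v')"
proof (rule ext, clarify)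
  fix c d
  have "amul (tensor_algebra H K) (tens u v) (tens u' v') (c, d) =
      (\<Sum>a\<in>bas H. \<Sum>b\<in>bas K. \<Sum>a'\<in>bas H. \<Sum>b'\<in>bas K.
        (u a * u' a' * bmul H a a' c) * (v b * v' b' * bmul K b b' d))"
    by (simp add: amul_def lincomb_def tensor_algebra_def tens_def sum.cartesian_product' mult_ac)
  also have "\<dots> = (\<Sum>a\<in>bas H. \<Sum>a'\<in>bas H. \<Sum>b\<in>bas K. \<Sum>b'\<in>bas K.
        (u a * u' a' * bmul H a a' c) * (v b * v' b' * bmul K b b' d))"
    by (intro sum.cong refl sum.swap)
  also have "\<dots> = (\<Sum>a\<in>bas H. \<Sum>a'\<in>bas H. u a * u' a' * bmul H a a' c) *
      (\<Sum>b\<in>bas K. \<Sum>b'\<in>bas K. v b * v' b' * bmul K b b' d)"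
    by (simp only: sum_distrib_right) (simp only: sum_distrib_left)
  finally show "amul (tensor_algebra H K) (tens u v) (tens u' v') (c, d) = tens (amul H u u') (amul K v v') (c, d)"
    by (simp add: tens_def amul_def lincomb_def sum.cartesian_product')
qed

lemma amul_tensor_basis:
  "amul (tensor_algebra H K) (basis_vec (a, b)) (basis_vec (a', b')) =
     tens (amul H (basis_vec a) (basis_vec a')) (amul K (basis_vec b) (basis_vec b'))"
  by (simp only: tens_basis_vec[symmetric] amul_tens)

lemma representation_lincomb:
  assumes "representation H \<rho>" "finite I" "\<And>i. i \<in> I \<Longrightarrow> v i \<in> elems H"
  shows "character \<rho> (lincomb I c v) = (\<Sum>i\<in>I. c i * character \<rho> (v i))"
  using assms(2,3)
proof (induction I rule: finite_induct)
  case empty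
  \<comment> \<open>The value at the zero vector comes from homogeneity with scalar 0.\<close>
  have "\<rho> (scal 0 (\<lambda>_. 0)) $ i $ j = 0" for i j
    using assms(1) by (simp add: representation_def elems_def)
  then show ?case
    by (simp add: character_def trace_def lincomb_def scal_def)
next
  case (insert i I)
  have "lincomb (insert i I) c v = (\<lambda>b. scal (c i) (v i) b + lincomb I c v b)"
    using insert by (auto simp: lincomb_def scal_def)
  moreover have "scal (c i) (v i) \<in> elems H" "lincomb I c v \<in> elems H"
    using insert by (auto intro: scal_elems lincomb_elems)
  ultimately have "\<rho> (lincomb (insert i I) c v) = \<rho> (scal (c i) (v i)) + \<rho> (lincomb I c v)"
    using assms(1) by (simp add: representation_def)
  moreover have "trace (\<rho> (scal (c i) (v i))) = c i * trace (\<rho> (v i))"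
    using assms(1) insert.prems by (auto simp: representation_def trace_def sum_distrib_left)
  ultimately show ?case
    using insert by (simp add: character_def trace_add)
qed

lemma lincomb_single:
  assumes "finite I" "a \<in> I" "\<And>i. i \<in> I \<Longrightarrow> i \<noteq> a \<Longrightarrow> c i = 0"
  shows "lincomb I c v = scal (c a) (v a)"
proof -
  have "lincomb I c v = lincomb {()} (\<lambda>_. c a) (\<lambda>_. v a)"
    by (rule lincomb_restrict[where f = "\<lambda>_. a"]) (use assms in \<open>auto simp: inj_on_def\<close>)
  then show ?thesis
    by (simp add: lincomb_def scal_def)
qed

lemma lincomb_scal_const: "lincomb I c (\<lambda>i. scal (k i) v) = scal (\<Sum>i\<in>I. c i * k i) v"
  by (simp add: lincomb_def scal_def sum_distrib_right mult.assoc)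

lemma amul_lincomb_left:
  "amul H (lincomb I c u) v = lincomb I c (\<lambda>i. amul H (u i) v)"
proof -
  have "amul H (lincomb I c u) v =
      lincomb (I \<times> {()}) (\<lambda>(i, j). c i * 1) (\<lambda>(i, j). amul H (u i) v)"
    using amul_lincomb[of H I c u "{()}" "\<lambda>_. 1" "\<lambda>_. v"] by (simp add: lincomb_singleton)
  also have "\<dots> = lincomb I c (\<lambda>i. amul H (u i) v)"
    unfolding lincomb_def by (simp add: sum.cartesian_product')
  finally show ?thesis .
qed

lemma lincomb_collapse_left:
  assumes "finite I" "finite J" "\<And>j. j \<in> J \<Longrightarrow> h j \<in> I"
    and "\<And>i j. i \<in> I \<Longrightarrow> j \<in> J \<Longrightarrow> i \<noteq> h j \<Longrightarrow> c (i, j) = 0"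
  shows "lincomb (I \<times> J) c v = lincomb J (\<lambda>j. c (h j, j)) (\<lambda>j. v (h j, j))"
  by (rule lincomb_restrict[where f = "\<lambda>j. (h j, j)"]) (use assms in \<open>auto simp: inj_on_def image_iff\<close>)

lemma lincomb_collapse_right:
  assumes "finite I" "finite J" "\<And>i. i \<in> I \<Longrightarrow> h i \<in> J"
    and "\<And>i j. i \<in> I \<Longrightarrow> j \<in> J \<Longrightarrow> j \<noteq> h i \<Longrightarrow> c (i, j) = 0"
  shows "lincomb (I \<times> J) c v = lincomb I (\<lambda>i. c (i, h i)) (\<lambda>i. v (i, h i))"
  by (rule lincomb_restrict[where f = "\<lambda>i. (i, h i)"]) (use assms in \<open>auto simp: inj_on_def image_iff\<close>)


section \<open>Exact factorizations and the cocycle\<close>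

locale transversal_cocycle = group G for G (structure) +
  fixes F Q :: "'a set" and \<omega> :: "'a \<Rightarrow> 'a \<Rightarrow> 'a \<Rightarrow> 'k::field_char_0"
  assumes finite_G: "finite (carrier G)" and F_subgroup: "subgroup F G"
    and transversal: "two_sided_transversal G F Q" and one_Q: "\<one> \<in> Q"
    and cocycle: "normalized_3_cocycle G \<omega>"
    and omega_F_left: "\<And>x a b. x \<in> F \<Longrightarrow> a \<in> carrier G \<Longrightarrow> b \<in> carrier G \<Longrightarrow> \<omega> x a b = 1"
    and omega_F_Q: "\<And>a x q. a \<in> carrier G \<Longrightarrow> x \<in> F \<Longrightarrow> q \<in> Q \<Longrightarrow> \<omega> a x q = 1"
begin

interpretation F: subgroup F G
  by (rule F_subgroup)

abbreviation rhd_op (infixl \<open>\<triangleright>\<close> 75) where "q \<triangleright> x \<equiv> rhd G F Q q x"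
abbreviation lhd_op (infixl \<open>\<triangleleft>\<close> 75) where "q \<triangleleft> x \<equiv> lhd G F Q q x"
abbreviation "\<theta> \<equiv> theta G F Q"
abbreviation "L \<equiv> linv G F Q"
abbreviation "R \<equiv> rinv G F Q"
abbreviation "\<pi> \<equiv> Q_part G F Q"
abbreviation "\<phi> \<equiv> F_part G F Q"

lemma F_G [simp]: "x \<in> F \<Longrightarrow> x \<in> carrier G"
  by (rule F.mem_carrier)

lemma Q_G [simp]: "q \<in> Q \<Longrightarrow> q \<in> carrier G"
  using transversal by (auto simp: two_sided_transversal_def)

lemma inv_cancel [simp]:
  assumes "x \<in> carrier G" "y \<in> carrier G"
  shows "x \<otimes> (inv x \<otimes> y) = y" "inv x \<otimes> (x \<otimes> y) = y"
  using assms by (simp_all add: m_assoc[symmetric])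

lemma finite_F: "finite F"
  using finite_G F.subset finite_subset by blast

lemma finite_Q: "finite Q"
  using finite_G Q_G finite_subset by (metis subsetI)

section \<open>Unique factorization and coset representatives\<close>

lemma factor_unique:
  assumes "x \<in> F" "q \<in> Q" "y \<in> F" "r \<in> Q" "x \<otimes> q = y \<otimes> r"
  shows "q = r" "x = y"
proof -
  have "q = (inv x \<otimes> y) \<otimes> r"
    using assms by (metis F_G Q_G inv_closed inv_cancel(2) m_assoc)
  then have "q \<in> F #> r" "r \<in> F #> r"
    using assms by (auto simp: r_coset_def intro!: bexI[of _ "inv x \<otimes> y"] bexI[of _ \<one>])
  then show "q = r"
    using transversal assms F.subset by (auto simp: two_sided_transversal_def dest!: bspec[of _ _ "F #> r"] intro: rcosetsI)
  then show "x = y"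
    using assms by simp
qed

text \<open>The hypothesis puts \<open>q\<close> and \<open>r\<close> into one left coset. This
  counterpart of \<open>factor_unique\<close> serves the uniqueness of right inverses.\<close>

lemma factor_unique':
  assumes "q \<in> Q" "r \<in> Q" "inv q \<otimes> r \<in> F"
  shows "q = r"
proof -
  have "r = q \<otimes> (inv q \<otimes> r)"
    using assms by simp
  then have "r \<in> q <# F" "q \<in> q <# F"
    using assms unfolding l_coset_def by (blast, auto intro!: bexI[of _ \<one>])
  moreover have "q <# F \<in> lcosets F"
    using assms by (auto simp: LCOSETS_def)
  ultimately show ?thesis
    using transversal assms by (auto simp: two_sided_transversal_def)
qed

lemma parts:
  assumes "x \<in> F" "q \<in> Q" "g = x \<otimes> q"
  shows "\<phi> g = x" "\<pi> g = q"
  using assms factor_unique unfolding F_part_def Q_part_def by (auto intro!: the_equality)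

text \<open>The representative of the coset \<open>F #> g\<close> has the form
  \<open>x \<otimes> g\<close> with \<open>x\<close> in \<open>F\<close>; moving \<open>x\<close> to
  the other side factors \<open>g\<close>.\<close>

lemma factorization:
  assumes "g \<in> carrier G"
  shows "\<phi> g \<in> F" "\<pi> g \<in> Q" "\<phi> g \<otimes> \<pi> g = g"
proof -
  obtain q where q: "q \<in> Q" "q \<in> F #> g"
    using transversal rcosetsI[OF F.subset assms] by (auto simp: two_sided_transversal_def)
  then obtain x where x: "x \<in> F" "q = x \<otimes> g"
    by (auto simp: r_coset_def)
  have g: "g = inv x \<otimes> q"
    unfolding x(2) using assms x(1) by simp
  have "\<phi> g = inv x" "\<pi> g = q"
    using parts[OF _ q(1) g] x(1) by auto
  then show "\<phi> g \<in> F" "\<pi> g \<in> Q" "\<phi> g \<otimes> \<pi> g = g"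
    using x(1) q(1) g[symmetric] by auto
qed

lemma Q_part_eq:
  assumes "g \<in> carrier G" "h \<in> carrier G" "g \<otimes> inv h \<in> F"
  shows "\<pi> g = \<pi> h"
proof -
  have "g = (g \<otimes> inv h \<otimes> \<phi> h) \<otimes> \<pi> h"
    using assms factorization[of h] by (simp add: m_assoc)
  then show ?thesis
    using assms factorization[of h] by (intro parts(2)[of "g \<otimes> inv h \<otimes> \<phi> h"]) auto
qed

lemma F_part_F: "x \<in> F \<Longrightarrow> \<phi> x = x"
  using parts(1)[of x \<one> x] one_Q by simp

lemma Q_part_Q: "q \<in> Q \<Longrightarrow> \<pi> q = q"
  using parts(2)[of \<one> q q] by simp

lemma Q_part_one_iff: "g \<in> carrier G \<Longrightarrow> \<pi> g = \<one> \<longleftrightarrow> g \<in> F"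
  using parts(2)[of g \<one> g] one_Q factorization[of g] by auto

lemma rhd_F [simp]: "q \<in> Q \<Longrightarrow> x \<in> F \<Longrightarrow> q \<triangleright> x \<in> F"
  and lhd_Q [simp]: "q \<in> Q \<Longrightarrow> x \<in> F \<Longrightarrow> q \<triangleleft> x \<in> Q"
  and rhd_lhd: "q \<in> Q \<Longrightarrow> x \<in> F \<Longrightarrow> (q \<triangleright> x) \<otimes> (q \<triangleleft> x) = q \<otimes> x"
  using factorization[of "q \<otimes> x"] by (auto simp: rhd_def lhd_def)

lemma theta_F [simp]: "p \<in> Q \<Longrightarrow> q \<in> Q \<Longrightarrow> \<theta> p q \<in> F"
  using factorization[of "p \<otimes> q"] by (auto simp: theta_def)

lemma theta_eq: "p \<in> Q \<Longrightarrow> q \<in> Q \<Longrightarrow> p \<otimes> q \<in> F \<Longrightarrow> \<theta> p q = p \<otimes> q"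
  by (simp add: theta_def F_part_F)

lemma dot_one_iff: "p \<in> Q \<Longrightarrow> q \<in> Q \<Longrightarrow> dot G F Q p q = \<one> \<longleftrightarrow> p \<otimes> q \<in> F"
  by (simp add: dot_def Q_part_one_iff)

text \<open>An equation between representatives becomes membership in \<open>F\<close>, which is
  settled by calculating in the group. Most later evaluations of \<open>\<triangleleft>\<close> go
  through this criterion.\<close>

lemma lhd_eq_iff:
  assumes "p \<in> Q" "x \<in> F" "q \<in> Q"
  shows "p \<triangleleft> x = q \<longleftrightarrow> p \<otimes> x \<otimes> inv q \<in> F"
proof
  assume "p \<triangleleft> x = q"
  then have "p \<otimes> x \<otimes> inv q = p \<triangleright> x"
    using rhd_lhd[of p x] assms by (metis F_G Q_G inv_solve_right rhd_F m_closed)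
  then show "p \<otimes> x \<otimes> inv q \<in> F"
    using assms by simp
next
  assume "p \<otimes> x \<otimes> inv q \<in> F"
  then have "\<pi> (p \<otimes> x) = \<pi> q"
    using assms by (intro Q_part_eq) auto
  then show "p \<triangleleft> x = q"
    using assms by (simp add: lhd_def Q_part_Q)
qed

section \<open>Left and right inverses in the transversal\<close>

lemma left_inverse:
  assumes "p \<in> Q"
  shows "L p \<in> Q" "L p \<otimes> p \<in> F"
    and "\<And>l. l \<in> Q \<Longrightarrow> l \<otimes> p \<in> F \<Longrightarrow> L p = l"
proof -
  \<comment> \<open>\<open>l \<otimes> p\<close> lies in \<open>F\<close> exactly when
    \<open>l\<close> lies in the right coset of \<open>inv p\<close>, so the candidate is the
    representative of that coset.\<close>
  let ?l = "\<pi> (inv p)"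
  have l: "?l \<in> Q" "?l \<otimes> p \<in> F"
  proof -
    show "?l \<in> Q"
      using assms by (intro factorization) simp
    have "?l = inv (\<phi> (inv p)) \<otimes> inv p"
      using assms factorization[of "inv p"] by (metis F_G Q_G inv_closed inv_cancel(2))
    then show "?l \<otimes> p \<in> F"
      using assms factorization[of "inv p"] by (simp add: m_assoc)
  qed
  have uniq: "l = ?l" if "l \<in> Q" "l \<otimes> p \<in> F" for l
    using Q_part_eq[of l "inv p"] that assms by (simp add: Q_part_Q)
  have "L p = ?l"
    unfolding linv_def
  proof (rule the_equality)
    show "?l \<in> Q \<and> dot G F Q ?l p = \<one>"
      using l assms by (simp add: dot_one_iff)
    show "m = ?l" if "m \<in> Q \<and> dot G F Q m p = \<one>" for m
      using that assms by (intro uniq) (auto simp: dot_one_iff[symmetric])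
  qed
  then show "L p \<in> Q" "L p \<otimes> p \<in> F" "\<And>l. l \<in> Q \<Longrightarrow> l \<otimes> p \<in> F \<Longrightarrow> L p = l"
    using l uniq by (metis, metis, metis)
qed

text \<open>\<open>p \<otimes> r\<close> lies in \<open>F\<close> exactly when \<open>r\<close> lies
  in \<open>inv p <# F\<close>. Existence and uniqueness therefore rest on \<open>Q\<close>
  representing the left cosets, whereas \<open>left_inverse\<close> works with right cosets.\<close>

lemma right_inverse:
  assumes "p \<in> Q"
  shows "R p \<in> Q" "p \<otimes> R p \<in> F"
    and "\<And>r. r \<in> Q \<Longrightarrow> p \<otimes> r \<in> F \<Longrightarrow> R p = r"
proof -
  have "inv p <# F \<in> lcosets F"
    using assms by (auto simp: LCOSETS_def)
  then obtain r where "r \<in> Q" "r \<in> inv p <# F"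
    using transversal by (auto simp: two_sided_transversal_def)
  then have r: "r \<in> Q" "p \<otimes> r \<in> F"
    using assms by (auto simp: l_coset_def)
  have uniq: "s = r" if "s \<in> Q" "p \<otimes> s \<in> F" for s
  proof (rule factor_unique'[symmetric])
    have "inv r \<otimes> s = inv (p \<otimes> r) \<otimes> (p \<otimes> s)"
      using assms r that by (simp add: inv_mult_group m_assoc)
    then show "inv r \<otimes> s \<in> F"
      using r that by simp
  qed (use r that in auto)
  have "R p = r"
    unfolding rinv_def
  proof (rule the_equality)
    show "r \<in> Q \<and> dot G F Q p r = \<one>"
      using r assms by (simp add: dot_one_iff)
    show "m = r" if "m \<in> Q \<and> dot G F Q p m = \<one>" for m
      using that assms by (intro uniq) (auto simp: dot_one_iff[symmetric])
  qed
  then show "R p \<in> Q" "p \<otimes> R p \<in> F" "\<And>r. r \<in> Q \<Longrightarrow> p \<otimes> r \<in> F \<Longrightarrow> R p = r"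
    using r uniq by (metis, metis, metis)
qed

declare left_inverse(1,2) [simp] right_inverse(1,2) [simp]

lemma R_L [simp]: "p \<in> Q \<Longrightarrow> R (L p) = p"
  by (simp add: right_inverse(3))

lemma L_R [simp]: "p \<in> Q \<Longrightarrow> L (R p) = p"
  by (simp add: left_inverse(3))

lemma lhd_one [simp]: "q \<in> Q \<Longrightarrow> q \<triangleleft> \<one> = q"
  by (simp add: lhd_eq_iff)

lemma lhd_lhd_inv [simp]:
  assumes "q \<in> Q" "x \<in> F"
  shows "q \<triangleleft> x \<triangleleft> inv x = q" "q \<triangleleft> inv x \<triangleleft> x = q"
proof -
  have "q \<triangleleft> x \<triangleleft> inv x = q" if "x \<in> F" for x
  proof -
    have "q \<triangleleft> x = inv (q \<triangleright> x) \<otimes> (q \<otimes> x)"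
      using rhd_lhd[of q x, symmetric] assms(1) that by simp
    then have "q \<triangleleft> x \<otimes> inv x \<otimes> inv q = inv (q \<triangleright> x)"
      using assms(1) that by (simp add: m_assoc)
    then show ?thesis
      using assms that by (simp add: lhd_eq_iff)
  qed
  from this[of x] this[of "inv x"] assms show "q \<triangleleft> x \<triangleleft> inv x = q" "q \<triangleleft> inv x \<triangleleft> x = q"
    by auto
qed

text \<open>\<open>p \<otimes> R p\<close> and
  \<open>(p \<triangleleft> x) \<otimes> R (p \<triangleleft> x)\<close> lie in \<open>F\<close>, so
  both values of \<open>\<theta>\<close> are plain products; \<open>rhd_lhd\<close> then makes
  \<open>p\<close> cancel. In this form the operation is handled by group calculations.\<close>

lemma succ_act_eq:
  assumes "p \<in> Q" "x \<in> F"
  shows "succ_act G F Q p x = inv (R p) \<otimes> x \<otimes> R (p \<triangleleft> x)"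
proof -
  have "(p \<triangleright> x) \<otimes> ((p \<triangleleft> x) \<otimes> R (p \<triangleleft> x)) = p \<otimes> (x \<otimes> R (p \<triangleleft> x))"
    using rhd_lhd[OF assms] assms by (simp add: m_assoc[symmetric])
  then show ?thesis
    using assms by (simp add: succ_act_def theta_eq inv_mult_group m_assoc)
qed

lemma succ_act_F [simp]: "p \<in> Q \<Longrightarrow> x \<in> F \<Longrightarrow> succ_act G F Q p x \<in> F"
  by (simp add: succ_act_def)

section \<open>Consequences of the cocycle identity relative to the subgroup\<close>

lemma omega_nonzero [simp]:
  "a \<in> carrier G \<Longrightarrow> b \<in> carrier G \<Longrightarrow> c \<in> carrier G \<Longrightarrow> \<omega> a b c \<noteq> 0"
  and omega_cocycle:
  "\<lbrakk>a \<in> carrier G; b \<in> carrier G; c \<in> carrier G; d \<in> carrier G\<rbrakk> \<Longrightarrow>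
     \<omega> (a \<otimes> b) c d * \<omega> a b (c \<otimes> d) = \<omega> a b c * \<omega> a (b \<otimes> c) d * \<omega> b c d"
  and omega_one [simp]:
  "a \<in> carrier G \<Longrightarrow> b \<in> carrier G \<Longrightarrow> \<omega> \<one> a b = 1"
  "a \<in> carrier G \<Longrightarrow> b \<in> carrier G \<Longrightarrow> \<omega> a \<one> b = 1"
  "a \<in> carrier G \<Longrightarrow> b \<in> carrier G \<Longrightarrow> \<omega> a b \<one> = 1"
  using cocycle by (auto simp: normalized_3_cocycle_def)

text \<open>The cocycle identity at \<open>f, a, b, c\<close>, in which the three factors with first
  argument \<open>f\<close> are 1. In its first argument \<open>\<omega>\<close> thus descends to
  right cosets of \<open>F\<close>.\<close>

lemma omega_F_mult:
  assumes "f \<in> F" "a \<in> carrier G" "b \<in> carrier G" "c \<in> carrier G"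
  shows "\<omega> (f \<otimes> a) b c = \<omega> a b c"
  using omega_cocycle[of f a b c] assms by (simp add: omega_F_left)

text \<open>Both \<open>a\<close> and \<open>b\<close> lie in the right coset of
  \<open>inv g\<close>. Describing the coset through \<open>g\<close> fits the uses, where products
  such as \<open>s \<otimes> q\<close> are known to lie in \<open>F\<close>.\<close>

lemma omega_coset:
  assumes "a \<in> carrier G" "b \<in> carrier G" "g \<in> carrier G" "a \<otimes> g \<in> F" "b \<otimes> g \<in> F"
    and "c \<in> carrier G" "d \<in> carrier G"
  shows "\<omega> a c d = \<omega> b c d"
proof -
  have "a = ((a \<otimes> g) \<otimes> inv (b \<otimes> g)) \<otimes> b"
    using assms by (simp add: inv_mult_group m_assoc)
  moreover have "(a \<otimes> g) \<otimes> inv (b \<otimes> g) \<in> F"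
    using assms by blast
  ultimately show ?thesis
    using omega_F_mult[of "(a \<otimes> g) \<otimes> inv (b \<otimes> g)" b c d] assms by simp
qed

lemma omega_lhd:
  assumes "q \<in> Q" "x \<in> F" "b \<in> carrier G" "c \<in> carrier G"
  shows "\<omega> (q \<otimes> x) b c = \<omega> (q \<triangleleft> x) b c"
  using omega_F_mult[of "q \<triangleright> x" "q \<triangleleft> x" b c] rhd_lhd[of q x] assms by simp

text \<open>The cocycle identity at \<open>a, f, b, c\<close>, where \<open>\<omega> f b c\<close>
  is 1. It carries an element of \<open>F\<close> from the second argument into the first.\<close>

lemma omega_shift:
  assumes "a \<in> carrier G" "f \<in> F" "b \<in> carrier G" "c \<in> carrier G"
  shows "\<omega> a (f \<otimes> b) c * \<omega> a f b = \<omega> (a \<otimes> f) b c * \<omega> a f (b \<otimes> c)"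
  using omega_cocycle[of a f b c] assms by (simp add: omega_F_left mult_ac)

lemma omega_inv:
  assumes "a \<in> carrier G" "x \<in> F"
  shows "\<omega> (a \<otimes> x) (inv x) x = \<omega> a x (inv x)"
  using omega_cocycle[of a x "inv x" x] assms by (simp add: omega_F_left)

text \<open>These are the scalars of the two products, in either order, of \<open>\<delta>\<close>
  at \<open>q\<close> with \<open>x\<close> and \<open>\<delta>\<close> at
  \<open>q \<triangleleft> x\<close> with \<open>inv x\<close>. Their equality lets one
  normalization serve both sides of the inverse associator.\<close>

lemma sigma_inv:
  assumes "q \<in> Q" "x \<in> F"
  shows "\<omega> (q \<triangleleft> x) (inv x) x = \<omega> q x (inv x)"
  using omega_inv[of q x] omega_lhd[of q x "inv x" x] assms by simp

text \<open>The coefficient of \<open>\<beta>\<close> at \<open>q\<close> is the product of the scalars contributed by \<open>\<Phi>\<^sup>-\<^sup>1\<close> and the antipode.\<close>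

lemma omega_beta:
  assumes "s \<in> Q" "q \<in> Q" "s \<otimes> q \<in> F"
  shows "\<omega> (inv q) q (inv q) =
    \<omega> (L (L s)) (L s) s * \<omega> (L (L s)) (L s \<otimes> s) (inv (L s \<otimes> s)) * \<omega> s q (inv (s \<otimes> q))"
proof -
  define c d where cd: "c = L s" "d = L c"
  have Q: "c \<in> Q" "d \<in> Q" "c \<otimes> s \<in> F" "d \<otimes> c \<in> F"
    using assms by (auto simp: cd)
  \<comment> \<open>\<open>s\<close> and \<open>inv q\<close> lie in the same right coset, because
    \<open>s \<otimes> q\<close> is in \<open>F\<close>.\<close>
  have 1: "\<omega> (inv q) q (inv q) = \<omega> s q (inv q)"
    using assms by (intro omega_coset[of _ _ q]) auto
  \<comment> \<open>The cocycle identity at \<open>s, q, inv (s \<otimes> q), s\<close>: of its five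
    factors, one has first argument in \<open>F\<close> and one has second argument in
    \<open>F\<close> with third in \<open>Q\<close>, so three remain.\<close>
  have 2: "\<omega> s q (inv q) = \<omega> s q (inv (s \<otimes> q)) * \<omega> s (inv s) s"
  proof -
    have "inv q = inv (s \<otimes> q) \<otimes> s" "inv s = q \<otimes> inv (s \<otimes> q)"
      using assms by (simp_all add: inv_mult_group m_assoc)
    then show ?thesis
      using omega_cocycle[of s q "inv (s \<otimes> q)" s] assms
      by (simp add: omega_F_Q omega_F_left)
  qed
  \<comment> \<open>Writing \<open>inv s\<close> as an element of \<open>F\<close> times
    \<open>c\<close> lets \<open>omega_shift\<close> turn the first argument into
    \<open>inv c\<close>, which may be replaced by \<open>d\<close> since
    \<open>d \<otimes> c\<close> is in \<open>F\<close>.\<close>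
  have 3: "\<omega> s (inv s) s = \<omega> d c s * \<omega> d (c \<otimes> s) (inv (c \<otimes> s))"
  proof -
    let ?x = "inv (c \<otimes> s)"
    have x: "?x \<in> F" "inv s = ?x \<otimes> c" "s \<otimes> ?x = inv c"
      using assms Q F.m_inv_closed[OF Q(3)] by (simp_all add: inv_mult_group m_assoc)
    have "\<omega> s (inv s) s = \<omega> (s \<otimes> ?x) c s * \<omega> s ?x (c \<otimes> s)"
      using omega_shift[of s ?x c s] x assms Q by (simp add: omega_F_Q)
    also have "\<omega> (s \<otimes> ?x) c s = \<omega> d c s"
      using x assms Q by (intro omega_coset[of _ _ c]) auto
    also have "\<omega> s ?x (c \<otimes> s) = \<omega> (s \<otimes> ?x) (c \<otimes> s) ?x"
      using omega_inv[of s ?x] x(1) assms Q by simp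
    also have "\<dots> = \<omega> d (c \<otimes> s) ?x"
      using x assms Q by (intro omega_coset[of _ _ c]) auto
    finally show ?thesis .
  qed
  show ?thesis
    using 1 2 3 by (simp add: cd)
qed

text \<open>The factor \<open>x\<close> in the first argument is dropped, and the other two
  occurrences of \<open>x \<otimes> q\<close> are split by cocycle identities with entries in
  \<open>F\<close>, using \<open>q \<otimes> x = f \<otimes> s\<close> for
  \<open>f = q \<triangleright> x\<close> and \<open>s = q \<triangleleft> x\<close>.\<close>

lemma omega_square:
  assumes "q \<in> Q" "x \<in> F" "(q \<triangleleft> x) \<otimes> q \<in> F"
  shows "\<omega> (x \<otimes> q) (x \<otimes> q) (x \<otimes> q) =
    \<omega> (q \<triangleleft> x) q x * \<omega> q x (q \<triangleright> x) * \<omega> (L (q \<triangleleft> x)) (q \<triangleleft> x) q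
      * \<omega> q (x \<otimes> (q \<triangleright> x)) ((q \<triangleleft> x) \<otimes> q)"
proof -
  define s f where sf: "s = q \<triangleleft> x" "f = q \<triangleright> x"
  have Q: "s \<in> Q" "f \<in> F" "s \<otimes> q \<in> F" and fs: "f \<otimes> s = q \<otimes> x"
    using assms rhd_lhd by (auto simp: sf)
  have 1: "\<omega> (x \<otimes> q) (x \<otimes> q) (x \<otimes> q) = \<omega> q (x \<otimes> q) (x \<otimes> q)"
    using assms by (simp add: omega_F_mult)
  have eq: "q \<otimes> (x \<otimes> q) = f \<otimes> (s \<otimes> q)"
    using fs assms Q by (simp add: m_assoc[symmetric])
  have 2: "\<omega> q (x \<otimes> q) (x \<otimes> q) = \<omega> s q (x \<otimes> q) * \<omega> q x (f \<otimes> (s \<otimes> q))"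
    using omega_shift[of q x q "x \<otimes> q"] omega_lhd[of q x q "x \<otimes> q"] assms
    by (simp add: eq omega_F_Q sf)
  have 3: "\<omega> s q (x \<otimes> q) = \<omega> s q x * \<omega> s (f \<otimes> s) q"
    using omega_cocycle[of s q x q] assms Q by (simp add: fs omega_F_Q omega_F_left)
  have 4: "\<omega> s (f \<otimes> s) q = \<omega> (s \<otimes> f) s q * \<omega> s f (s \<otimes> q)"
    using omega_shift[of s f s q] assms Q by (simp add: omega_F_Q)
  \<comment> \<open>The product equals \<open>(s \<otimes> q) \<otimes> x\<close>; hence
    \<open>s \<otimes> f\<close> and \<open>L s\<close> both lie in the right coset of
    \<open>inv s\<close>.\<close>
  have "s \<otimes> f \<otimes> s \<in> F"
    using Q assms fs by (simp add: m_assoc) (simp add: m_assoc[symmetric])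
  then have 5: "\<omega> (s \<otimes> f) s q = \<omega> (L s) s q"
    using Q assms by (intro omega_coset[of _ _ s]) auto
  \<comment> \<open>The cocycle identity at \<open>q, x, f, s \<otimes> q\<close> trades the two
    leftover factors for the two wanted ones.\<close>
  have 6: "\<omega> s f (s \<otimes> q) * \<omega> q x (f \<otimes> (s \<otimes> q)) = \<omega> q x f * \<omega> q (x \<otimes> f) (s \<otimes> q)"
    using omega_cocycle[of q x f "s \<otimes> q"] omega_lhd[of q x f "s \<otimes> q"] assms Q
    by (simp add: omega_F_left sf)
  have "\<omega> (x \<otimes> q) (x \<otimes> q) (x \<otimes> q) =
      \<omega> s q x * \<omega> (L s) s q * (\<omega> s f (s \<otimes> q) * \<omega> q x (f \<otimes> (s \<otimes> q)))"
    by (simp add: 1 2 3 4 5)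
  then show ?thesis
    unfolding 6 by (simp add: sf)
qed


section \<open>The integral and the inverse associator\<close>

abbreviation "H \<equiv> Aop G F Q \<omega>"
abbreviation "D p x \<equiv> (basis_vec (p, x) :: 'a \<times> 'a \<Rightarrow> 'k)"
abbreviation "T \<equiv> tensor_algebra H (tensor_algebra H H)"

lemma bas_H [simp]: "bas H = Q \<times> F"
  by (simp add: Aop_def op_algebra_def algA_def)

lemma finite_bas: "finite (bas H)"
  by (simp add: finite_F finite_Q)

text \<open>The product is that of the opposite algebra: the right factor \<open>D q y\<close> is
  the one multiplied first in \<open>A\<close>, hence the matching condition on
  \<open>q \<triangleleft> y\<close> and the order \<open>y \<otimes> x\<close>.\<close>

lemma mult_D:
  assumes "p \<in> Q" "x \<in> F" "q \<in> Q" "y \<in> F"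
  shows "amul H (D p x) (D q y) = scal (if q \<triangleleft> y = p then \<omega> q y x else 0) (D q (y \<otimes> x))"
proof -
  have "amul H (D p x) (D q y) = bmul H (p, x) (q, y)"
    using assms by (intro amul_basis finite_bas) auto
  then show ?thesis
    by (simp add: Aop_def op_algebra_def algA_def sigma_coc_def)
qed

lemma bunit_H: "bunit H = lincomb Q (\<lambda>_. 1) (\<lambda>p. D p \<one>)"
  by (simp add: Aop_def op_algebra_def algA_def)

lemma alpha_H: "alpha H = bunit H"
  by (simp add: Aop_def op_algebra_def)

lemma mult_unit_right:
  assumes "p \<in> Q" "x \<in> F"
  shows "amul H (D p x) (bunit H) = D p x"
proof -
  have "amul H (D p x) (bunit H) =
      lincomb Q (\<lambda>q. 1) (\<lambda>q. scal (if q = p then 1 else 0) (D q x))"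
    unfolding bunit_H amul_lincomb_right using assms
    by (intro lincomb_cong) (auto simp: mult_D)
  also have "\<dots> = D p x"
    unfolding lincomb_scal using assms finite_Q by (subst lincomb_single[where a = p]) auto
  finally show ?thesis .
qed

section \<open>The normalized integral and its coproduct\<close>

lemma one_lhd [simp]: "x \<in> F \<Longrightarrow> \<one> \<triangleleft> x = \<one>"
  using one_Q by (simp add: lhd_eq_iff)

lemma lhd_eq_one_iff: "q \<in> Q \<Longrightarrow> x \<in> F \<Longrightarrow> q \<triangleleft> x = \<one> \<longleftrightarrow> q = \<one>"
  by (metis F.m_inv_closed lhd_lhd_inv(1) one_lhd)

text \<open>A basis element \<open>D q y\<close> annihilates the sum unless
  \<open>q = \<one>\<close>, and \<open>D \<one> y\<close> merely translates \<open>F\<close>, with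
  all scalars 1 by normalization of \<open>\<omega>\<close>.\<close>

lemma norm_integral_H:
  "norm_integral H = lincomb F (\<lambda>_. inverse (of_nat (card F))) (\<lambda>x. D \<one> x)" (is "_ = ?L")
proof -
  \<comment> \<open>Characteristic zero enters here, to make the weight invertible.\<close>
  have card: "of_nat (card F) \<noteq> (0 :: 'k)"
    using finite_F F.one_closed by (auto simp del: F.one_closed)
  have eps_D: "eps H (D q y) = (if q = \<one> then 1 else 0)" if "q \<in> Q" "y \<in> F" for q y
  proof -
    have "eps H (D q y) = (\<Sum>b\<in>Q \<times> F. if b = (q, y) then bcounit H b else 0)"
      unfolding eps_def by (intro sum.cong) (auto simp: basis_vec_def)
    then show ?thesis
      using that finite_F finite_Q by (simp add: Aop_def)
  qed
  have L_elems: "?L \<in> elems H"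
    using one_Q by (intro lincomb_elems basis_vec_elems) auto
  have eps_lincomb: "eps H (lincomb I c v) = (\<Sum>i\<in>I. c i * eps H (v i))"
    for I and c :: "'i \<Rightarrow> 'k" and v
  proof -
    have "eps H (lincomb I c v) = (\<Sum>b\<in>bas H. \<Sum>i\<in>I. c i * (v i b * bcounit H b))"
      by (simp add: eps_def lincomb_def sum_distrib_right mult.assoc del: bas_H)
    also have "\<dots> = (\<Sum>i\<in>I. \<Sum>b\<in>bas H. c i * (v i b * bcounit H b))"
      by (rule sum.swap)
    finally show ?thesis
      by (simp add: eps_def sum_distrib_left del: bas_H)
  qed
  have L_eps: "eps H ?L = 1"
    using one_Q card by (simp add: eps_lincomb eps_D)
  have shift: "lincomb F c (\<lambda>x. D \<one> (g x)) = lincomb F c (\<lambda>x. D \<one> x)"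
    if "bij_betw g F F" "\<And>x y. c x = c y" for g and c :: "'a \<Rightarrow> 'k"
  proof (rule lincomb_restrict[where f = "inv_into F g"])
    show "inj_on (inv_into F g) F"
      using that(1) by (metis bij_betw_def bij_betw_inv_into)
    show "c (inv_into F g x) = c x" for x
      by (rule that(2))
    show "c i = 0" if i: "i \<in> F" "i \<notin> inv_into F g ` F" for i
      using i \<open>bij_betw g F F\<close> bij_betw_inv_into[OF \<open>bij_betw g F F\<close>] by (auto simp: bij_betw_def)
    show "inv_into F g x \<in> F" "D \<one> (g (inv_into F g x)) = D \<one> x" if "x \<in> F" for x
      using that \<open>bij_betw g F F\<close> by (auto simp: bij_betw_def inv_into_into f_inv_into_f)
  qed (rule finite_F)
  have bij: "bij_betw (\<lambda>x. x \<otimes> y) F F" "bij_betw (\<lambda>x. y \<otimes> x) F F" if "y \<in> F" for y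
    subgoal using that by (intro bij_betwI[where g = "\<lambda>x. x \<otimes> inv y"]) (auto simp: m_assoc)
    subgoal using that by (intro bij_betwI[where g = "\<lambda>x. inv y \<otimes> x"]) auto
    done
  have left: "amul H (D q y) ?L = scal (eps H (D q y)) ?L" if "q \<in> Q" "y \<in> F" for q y
  proof -
    have "amul H (D q y) ?L = lincomb F (\<lambda>_. inverse (of_nat (card F)))
        (\<lambda>x. scal (eps H (D q y)) (D \<one> (x \<otimes> y)))"
      unfolding amul_lincomb_right using that one_Q
      by (intro lincomb_cong) (auto simp: mult_D eps_D)
    also have "\<dots> = lincomb F (\<lambda>_. inverse (of_nat (card F)) * eps H (D q y)) (\<lambda>x. D \<one> x)"
      unfolding lincomb_scal using that by (intro shift bij) auto
    finally show ?thesis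
      by (simp add: scal_lincomb mult.commute)
  qed
  have right: "amul H ?L (D q y) = scal (eps H (D q y)) ?L" if "q \<in> Q" "y \<in> F" for q y
  proof -
    have "amul H ?L (D q y) = lincomb F (\<lambda>_. inverse (of_nat (card F)))
        (\<lambda>x. scal (eps H (D q y)) (D \<one> (y \<otimes> x)))"
      unfolding amul_lincomb_left using that one_Q
      by (intro lincomb_cong) (auto simp: mult_D eps_D lhd_eq_one_iff scal_def)
    also have "\<dots> = lincomb F (\<lambda>_. inverse (of_nat (card F)) * eps H (D q y)) (\<lambda>x. D \<one> x)"
      unfolding lincomb_scal using that by (intro shift bij) auto
    finally show ?thesis
      by (simp add: scal_lincomb mult.commute)
  qed
  have two_sided: "amul H h ?L = scal (eps H h) ?L \<and> amul H ?L h = scal (eps H h) ?L"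
    if "h \<in> elems H" for h
  proof -
    have h: "h = lincomb (bas H) h basis_vec"
      using that finite_bas by (rule lincomb_expand[rotated])
    have "amul H h ?L = lincomb (bas H) h (\<lambda>b. amul H (basis_vec b) ?L)"
      by (subst h) (rule amul_lincomb_left)
    moreover have "amul H ?L h = lincomb (bas H) h (\<lambda>b. amul H ?L (basis_vec b))"
      by (subst h) (rule amul_lincomb_right)
    moreover have "lincomb (bas H) h (\<lambda>b. amul H (basis_vec b) ?L) =
        lincomb (bas H) h (\<lambda>b. scal (eps H (basis_vec b)) ?L)"
      by (intro lincomb_cong) (auto simp: left)
    moreover have "lincomb (bas H) h (\<lambda>b. amul H ?L (basis_vec b)) =
        lincomb (bas H) h (\<lambda>b. scal (eps H (basis_vec b)) ?L)"
      by (intro lincomb_cong) (auto simp: right)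
    moreover have "(\<Sum>b\<in>bas H. h b * eps H (basis_vec b)) = eps H h"
      by (subst (2) h) (simp add: eps_lincomb)
    ultimately show ?thesis
      by (simp only: lincomb_scal_const)
  qed
  show ?thesis
    unfolding norm_integral_def
  proof (rule the_equality)
    show "?L \<in> elems H \<and> eps H ?L = 1 \<and>
        (\<forall>h\<in>elems H. amul H h ?L = scal (eps H h) ?L \<and> amul H ?L h = scal (eps H h) ?L)"
      using L_elems L_eps two_sided by blast
  next
    fix M
    assume M: "M \<in> elems H \<and> eps H M = 1 \<and>
        (\<forall>h\<in>elems H. amul H h M = scal (eps H h) M \<and> amul H M h = scal (eps H h) M)"
    \<comment> \<open>Two normalized two-sided integrals both coincide with their product.\<close>
    have "M = amul H M ?L"
      using M L_elems L_eps by (metis scal_one)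
    also have "\<dots> = ?L"
      using M two_sided by (metis scal_one)
    finally show "M = ?L" .
  qed
qed

text \<open>Only the elements \<open>D \<one> x\<close> are expanded, and
  \<open>dot G F Q s t = \<one>\<close> forces \<open>s = L t\<close>, so the coproduct sum runs
  over \<open>t\<close> alone.\<close>

lemma Delta_norm_integral:
  "Delta H (norm_integral H) =
     lincomb (F \<times> Q) (\<lambda>(x, t). inverse (of_nat (card F)) * \<omega> (L t) t x)
       (\<lambda>(x, t). tens (D (L t) (t \<triangleright> x)) (D t x))"
proof -
  have "bcomult H (\<one>, x) = lincomb Q (\<lambda>t. \<omega> (L t) t x) (\<lambda>t. tens (D (L t) (t \<triangleright> x)) (D t x))" (is "?l = ?r")
    if "x \<in> F" for x
  proof -
    have fin: "finite {(s, t). s \<in> Q \<and> t \<in> Q \<and> dot G F Q s t = \<one>}"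
      by (rule finite_subset[of _ "Q \<times> Q"]) (auto simp: finite_Q)
    have im: "{(s, t). s \<in> Q \<and> t \<in> Q \<and> dot G F Q s t = \<one>} = (\<lambda>t. (L t, t)) ` Q"
      using left_inverse(3) by (auto simp: dot_one_iff image_iff)
    show ?thesis
      unfolding Aop_def
      by (simp add: tau_coc_def, rule lincomb_restrict[where f = "\<lambda>t. (L t, t)"])
        (use fin im in \<open>auto simp: inj_on_def tau_coc_def\<close>)
  qed
  then have "Delta H (norm_integral H) =
      lincomb F (\<lambda>_. inverse (of_nat (card F)))
        (\<lambda>x. lincomb Q (\<lambda>t. \<omega> (L t) t x) (\<lambda>t. tens (D (L t) (t \<triangleright> x)) (D t x)))"
    unfolding Delta_def norm_integral_H lincomb_linear using one_Q finite_bas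
    by (intro lincomb_cong) (auto simp: lincomb_basis_vec)
  then show ?thesis
    by (simp add: lincomb_lincomb)
qed

section \<open>The inverse of the associator\<close>

lemma mult_T:
  assumes "p \<in> Q" "q \<in> Q" "r \<in> Q" "p' \<in> Q" "q' \<in> Q" "r' \<in> Q"
    and "x \<in> F" "y \<in> F" "z \<in> F" "x' \<in> F" "y' \<in> F" "z' \<in> F"
  shows "amul T (basis_vec ((p, x), (q, y), (r, z))) (basis_vec ((p', x'), (q', y'), (r', z'))) =
    scal ((if p' \<triangleleft> x' = p then \<omega> p' x' x else 0) *
        ((if q' \<triangleleft> y' = q then \<omega> q' y' y else 0) * (if r' \<triangleleft> z' = r then \<omega> r' z' z else 0)))
      (basis_vec ((p', x' \<otimes> x), (q', y' \<otimes> y), (r', z' \<otimes> z)))"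
  using assms by (simp add: amul_tensor_basis mult_D tens_scal tens_basis_vec split del: if_split)

lemma bas_T: "bas T = (Q \<times> F) \<times> (Q \<times> F) \<times> (Q \<times> F)"
  by (simp add: tensor_algebra_def)

lemma bunit_T:
  "bunit T = lincomb (Q \<times> Q \<times> Q) (\<lambda>_. 1) (\<lambda>(p, q, r). basis_vec ((p, \<one>), (q, \<one>), (r, \<one>)))"
  unfolding tensor_algebra_def
  by (simp add: bunit_H tens_lincomb) (intro lincomb_cong, auto simp: tens_basis_vec)

lemma associator_H:
  "associator H = lincomb (Q \<times> Q \<times> Q) (\<lambda>(p, q, r). \<omega> p q r)
     (\<lambda>(p, q, r). basis_vec ((p, \<theta> q r), (q, \<one>), (r, \<one>)))"
  by (simp add: Aop_def tens_basis_vec)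

text \<open>Right multiplication by the associator sends each basis vector to a nonzero multiple of
  a basis vector, injectively on indices. Uniqueness of the inverse follows without appeal to
  associativity of \<open>T\<close>.\<close>

lemma associator_cancel:
  assumes u: "u \<in> elems T" and v: "v \<in> elems T"
    and eq: "amul T u (associator H) = amul T v (associator H)"
  shows "u = v"
proof -
  \<comment> \<open>The only term of the associator that matches a given basis vector has
    \<open>q' = q\<close>, \<open>r' = r\<close> and
    \<open>p' = p \<triangleleft> inv \<theta> q r\<close>; \<open>h\<close> gives the resulting
    index and \<open>k\<close> the scalar.\<close>
  define h where "h = (\<lambda>((p, x), (q, y), (r, z)). ((p \<triangleleft> inv \<theta> q r, \<theta> q r \<otimes> x), (q, y :: 'a), (r, z :: 'a)))"
  define k where "k = (\<lambda>((p, x), (q, y :: 'a), (r, z :: 'a)).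
    \<omega> (p \<triangleleft> inv \<theta> q r) q r * \<omega> (p \<triangleleft> inv \<theta> q r) (\<theta> q r) x)"
  have fin: "finite (bas T)" "finite (Q \<times> Q \<times> Q)"
    by (simp_all add: bas_T finite_F finite_Q)
  have monomial: "amul T u (associator H) = lincomb (bas T) (\<lambda>b. u b * k b) (\<lambda>b. basis_vec (h b))"
    if "u \<in> elems T" for u
  proof -
    define c where "c = (\<lambda>(((p, x), (q, y :: 'a), (r, z :: 'a)), (p', q', r')).
      if p' \<triangleleft> \<theta> q' r' = p \<and> q' = q \<and> r' = r then \<omega> p' q' r' * \<omega> p' (\<theta> q' r') x else 0)"
    define w where "w = (\<lambda>(((p :: 'a, x), (q :: 'a, y :: 'a), (r :: 'a, z :: 'a)), (p' :: 'a, q', r')).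
      basis_vec ((p', \<theta> q' r' \<otimes> x), (q', y), (r', z)) :: _ \<Rightarrow> 'k)"
    define g where "g = (\<lambda>((p, x), (q, y :: 'a), (r, z :: 'a)).
      (((p, x :: 'a), (q, y), (r, z)), (p \<triangleleft> inv \<theta> q r, q, r)))"
    have "amul T u (associator H) = amul T (lincomb (bas T) u basis_vec) (associator H)"
      using lincomb_expand[OF fin(1) that] by simp
    also have "\<dots> = lincomb (bas T \<times> (Q \<times> Q \<times> Q)) (\<lambda>i. u (fst i)) (\<lambda>i. scal (c i) (w i))"
      unfolding associator_H amul_lincomb
    proof (rule lincomb_cong_scal)
      fix i
      assume "i \<in> bas T \<times> Q \<times> Q \<times> Q"
      then obtain p x q y r z p' q' r' where i: "i = (((p, x), (q, y), (r, z)), (p', q', r'))"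
        and Q: "p \<in> Q" "q \<in> Q" "r \<in> Q" "x \<in> F" "y \<in> F" "z \<in> F" "p' \<in> Q" "q' \<in> Q" "r' \<in> Q"
        by (auto simp: bas_T)
      show "scal (case i of (i, j) \<Rightarrow> u i * (case j of (p, q, r) \<Rightarrow> \<omega> p q r))
          (case i of (i, j) \<Rightarrow> amul T (basis_vec i)
            (case j of (p, q, r) \<Rightarrow> basis_vec ((p, \<theta> q r), (q, \<one>), (r, \<one>)))) =
        scal (u (fst i)) (scal (c i) (w i))"
        using Q by (simp add: i c_def w_def mult_T mult.assoc)
    qed
    also have "\<dots> = lincomb (bas T) (\<lambda>b. u b * k b) (\<lambda>b. basis_vec (h b))"
      unfolding lincomb_scal
    proof (rule lincomb_restrict[where f = g])
      show "finite (bas T \<times> Q \<times> Q \<times> Q)"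
        using fin by simp
      show "inj_on g (bas T)"
        by (auto simp: inj_on_def g_def)
      show "u (fst i) * c i = 0" if i: "i \<in> bas T \<times> Q \<times> Q \<times> Q" "i \<notin> g ` bas T" for i
      proof -
        obtain p x q y r z p' q' r' where i_eq: "i = (((p, x), (q, y), (r, z)), (p', q', r'))"
          by (metis surj_pair)
        have "\<not> (p' \<triangleleft> \<theta> q' r' = p \<and> q' = q \<and> r' = r)"
        proof
          assume "p' \<triangleleft> \<theta> q' r' = p \<and> q' = q \<and> r' = r"
          then have "i = g ((p, x), (q, y), (r, z))"
            using i(1) by (auto simp: i_eq g_def)
          then show False
            using i by (auto simp: i_eq)
        qed
        then show ?thesis
          by (auto simp: i_eq c_def)
      qed
      fix b
      assume "b \<in> bas T"
      then obtain p x q y r z where b: "b = ((p, x), (q, y), (r, z))"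
        and Q: "p \<in> Q" "x \<in> F" "q \<in> Q" "y \<in> F" "r \<in> Q" "z \<in> F"
        by (auto simp: bas_T)
      show "g b \<in> bas T \<times> Q \<times> Q \<times> Q" "u (fst (g b)) * c (g b) = u b * k b"
        "w (g b) = basis_vec (h b)"
        using Q by (simp_all add: b g_def c_def k_def w_def h_def bas_T)
    qed
    finally show ?thesis .
  qed
  have inj: "inj_on h (bas T)"
    by (rule inj_on_inverseI[where g = "\<lambda>((p, x), (q, y), (r, z)). ((p \<triangleleft> \<theta> q r, inv \<theta> q r \<otimes> x), (q, y), (r, z))"])
      (auto simp: bas_T h_def)
  have nz: "k b \<noteq> 0" if "b \<in> bas T" for b
    using that by (auto simp: bas_T k_def)
  have eq': "lincomb (bas T) (\<lambda>b. u b * k b) (\<lambda>b. basis_vec (h b)) =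
      lincomb (bas T) (\<lambda>b. v b * k b) (\<lambda>b. basis_vec (h b))"
    using eq by (simp only: monomial[OF u] monomial[OF v])
  show ?thesis
  proof
    fix b
    show "u b = v b"
    proof (cases "b \<in> bas T")
      case True
      show ?thesis
        by (rule monomial_map_cancel[OF fin(1) inj _ eq' True]) (rule nz)
    next
      case False
      then show ?thesis
        using elems_zero[OF u False] elems_zero[OF v False] by simp
    qed
  qed
qed

text \<open>Up to the scalar of \<open>sigma_inv\<close>, \<open>D p f\<close> and
  \<open>D (p \<triangleleft> f) (inv f)\<close> multiply in either order to an idempotent with
  \<open>F\<close>-component \<open>\<one>\<close>. The terms of the associator are inverted one by
  one in this way, and the idempotents add up to the unit.\<close>

lemma associator_inv_H:
  "associator_inv H = lincomb (Q \<times> Q \<times> Q)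
     (\<lambda>(p, q, r). inverse (\<omega> p q r) * inverse (\<omega> p (\<theta> q r) (inv \<theta> q r)))
     (\<lambda>(p, q, r). basis_vec ((p \<triangleleft> \<theta> q r, inv \<theta> q r), (q, \<one>), (r, \<one>)))" (is "_ = ?V")
proof -
  have fin: "finite ((Q \<times> Q \<times> Q) \<times> (Q \<times> Q \<times> Q))"
    by (simp add: finite_Q)
  have V: "?V \<in> elems T"
    by (intro lincomb_elems) (auto intro!: basis_vec_elems simp: bas_T)
  have 1: "amul T (associator H) ?V = bunit T"
  proof -
    define c where "c = (\<lambda>((p :: 'a, q :: 'a, r :: 'a), (p', q', r')).
      if p' = p \<and> q' = q \<and> r' = r then 1 else 0 :: 'k)"
    define w where "w = (\<lambda>((p :: 'a, q :: 'a, r :: 'a), (p', q', r')).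
      basis_vec ((p' \<triangleleft> \<theta> q' r', inv \<theta> q' r' \<otimes> \<theta> q r), (q', \<one>), (r', \<one>)) :: _ \<Rightarrow> 'k)"
    \<comment> \<open>In this order the idempotent obtained sits at
      \<open>p \<triangleleft> \<theta> q r\<close>, so the summation index is shifted back by
      \<open>inv \<theta> q r\<close>; the opposite order below has no such shift.\<close>
    define g where "g = (\<lambda>(p, q, r). ((p \<triangleleft> inv \<theta> q r, q, r), (p \<triangleleft> inv \<theta> q r, q, r)))"
    have "amul T (associator H) ?V = lincomb ((Q \<times> Q \<times> Q) \<times> (Q \<times> Q \<times> Q)) c w"
      unfolding associator_H amul_lincomb
    proof (rule lincomb_cong_scal, clarify)
      fix p q r p' q' r'
      assume Q: "p \<in> Q" "q \<in> Q" "r \<in> Q" "p' \<in> Q" "q' \<in> Q" "r' \<in> Q"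
      have "\<omega> p q r * (inverse (\<omega> p q r) * inverse (\<omega> p (\<theta> q r) (inv \<theta> q r)))
          * \<omega> p (\<theta> q r) (inv \<theta> q r) = 1"
        using Q by (simp add: field_simps)
      then show "scal (\<omega> p q r * (inverse (\<omega> p' q' r') * inverse (\<omega> p' (\<theta> q' r') (inv \<theta> q' r'))))
          (amul T (basis_vec ((p, \<theta> q r), (q, \<one>), (r, \<one>)))
            (basis_vec ((p' \<triangleleft> \<theta> q' r', inv \<theta> q' r'), (q', \<one>), (r', \<one>)))) =
          scal (c ((p, q, r), (p', q', r'))) (w ((p, q, r), (p', q', r')))"
        using Q by (auto simp: c_def w_def mult_T sigma_inv)
    qed
    also have "\<dots> = bunit T"
      unfolding bunit_T
    proof (rule lincomb_restrict[where f = g])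
      show "inj_on g (Q \<times> Q \<times> Q)"
        by (rule inj_on_inverseI[where g = "\<lambda>((p, q, r), _). (p \<triangleleft> \<theta> q r, q, r)"]) (auto simp: g_def)
      show "c i = 0" if i: "i \<in> (Q \<times> Q \<times> Q) \<times> (Q \<times> Q \<times> Q)" "i \<notin> g ` (Q \<times> Q \<times> Q)" for i
      proof (rule ccontr)
        assume "c i \<noteq> 0"
        then obtain p q r where "i = ((p, q, r), (p, q, r))"
          by (cases i) (auto simp: c_def split: if_splits)
        then have "i = g (p \<triangleleft> \<theta> q r, q, r)" "(p \<triangleleft> \<theta> q r, q, r) \<in> Q \<times> Q \<times> Q"
          using i(1) by (simp_all add: g_def)
        then show False
          using i(2) by blast
      qed
    qed (use fin in \<open>auto simp: g_def c_def w_def\<close>)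
    finally show ?thesis .
  qed
  have 2: "amul T ?V (associator H) = bunit T"
  proof -
    define c where "c = (\<lambda>((p :: 'a, q :: 'a, r :: 'a), (p', q', r')).
      if p' = p \<and> q' = q \<and> r' = r then 1 else 0 :: 'k)"
    define w where "w = (\<lambda>((p :: 'a, q :: 'a, r :: 'a), (p' :: 'a, q', r')).
      basis_vec ((p', \<theta> q' r' \<otimes> inv \<theta> q r), (q', \<one>), (r', \<one>)) :: _ \<Rightarrow> 'k)"
    have "amul T ?V (associator H) = lincomb ((Q \<times> Q \<times> Q) \<times> (Q \<times> Q \<times> Q)) c w"
      unfolding associator_H amul_lincomb
    proof (rule lincomb_cong_scal, clarify)
      fix p q r p' q' r'
      assume Q: "p \<in> Q" "q \<in> Q" "r \<in> Q" "p' \<in> Q" "q' \<in> Q" "r' \<in> Q"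
      have "inverse (\<omega> p q r) * inverse (\<omega> p (\<theta> q r) (inv \<theta> q r)) * \<omega> p q r
          * \<omega> p (\<theta> q r) (inv \<theta> q r) = 1"
        using Q by (simp add: field_simps)
      moreover have "p' \<triangleleft> \<theta> q r = p \<triangleleft> \<theta> q r \<longleftrightarrow> p' = p"
        using Q by (metis lhd_lhd_inv(1) theta_F)
      ultimately show "scal (inverse (\<omega> p q r) * inverse (\<omega> p (\<theta> q r) (inv \<theta> q r)) * \<omega> p' q' r')
          (amul T (basis_vec ((p \<triangleleft> \<theta> q r, inv \<theta> q r), (q, \<one>), (r, \<one>)))
            (basis_vec ((p', \<theta> q' r'), (q', \<one>), (r', \<one>)))) =
          scal (c ((p, q, r), (p', q', r'))) (w ((p, q, r), (p', q', r')))"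
        using Q by (auto simp: c_def w_def mult_T)
    qed
    also have "\<dots> = bunit T"
      unfolding bunit_T
      by (rule lincomb_restrict[where f = "\<lambda>i. (i, i)"], goal_cases)
        (use fin in \<open>auto simp: inj_on_def c_def w_def image_iff\<close>)
    finally show ?thesis .
  qed
  show ?thesis
    unfolding associator_inv_def algebra_inverse_def
  proof (rule the_equality)
    show "?V \<in> elems T \<and> amul T (associator H) ?V = bunit T \<and> amul T ?V (associator H) = bunit T"
      using V 1 2 by blast
    show "v = ?V" if "v \<in> elems T \<and> amul T (associator H) v = bunit T \<and> amul T v (associator H) = bunit T" for v
      by (rule associator_cancel) (use that V 2 in simp_all)
  qed
qed


section \<open>The antipode and the elements q and p\<close>

abbreviation succ_op (infixl \<open>\<succ>\<close> 75) where "p \<succ> x \<equiv> succ_act G F Q p x"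

section \<open>The antipode and its inverse on basis elements\<close>

definition antipode_coeff :: "'a \<Rightarrow> 'a \<Rightarrow> 'k" where
  "antipode_coeff p x = inverse (\<omega> p (R p) (p \<succ> x)) * inverse (\<omega> (R p) (p \<succ> x) (inv (p \<succ> x)))"

lemma antipode_coeff_nonzero: "p \<in> Q \<Longrightarrow> x \<in> F \<Longrightarrow> antipode_coeff p x \<noteq> 0"
  by (simp add: antipode_coeff_def)

lemma antip_D:
  "p \<in> Q \<Longrightarrow> x \<in> F \<Longrightarrow> antip H (D p x) = scal (antipode_coeff p x) (D (R (p \<triangleleft> x)) (inv (p \<succ> x)))"
  unfolding antip_def using finite_bas
  by (simp add: lincomb_basis_vec) (simp add: Aop_def antipode_coeff_def tau_coc_def sigma_coc_def)

lemma rhd_lhd_parts: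
  assumes "a \<in> Q" "z \<in> F" "x \<in> F" "q \<in> Q" "a \<otimes> z = x \<otimes> q"
  shows "a \<triangleright> z = x" "a \<triangleleft> z = q"
  using parts[of x q "a \<otimes> z"] assms by (simp_all add: rhd_def lhd_def)

text \<open>\<open>antip_inv\<close> is an \<open>inv_into\<close>, so evaluating it takes
  injectivity, which holds because the antipode is monomial.\<close>

lemma antip_inj: "inj_on (antip H) (elems H)"
proof (rule inj_onI)
  fix u v
  assume u: "u \<in> elems H" and v: "v \<in> elems H" and eq: "antip H u = antip H v"
  define h where "h = (\<lambda>(p, x). (R (p \<triangleleft> x), inv (p \<succ> x)))"
  have monomial: "antip H u = lincomb (bas H) (\<lambda>b. u b * antipode_coeff (fst b) (snd b)) (\<lambda>b. basis_vec (h b))"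
    for u
    unfolding antip_def lincomb_scal[symmetric]
    by (intro lincomb_cong)
      (auto simp: h_def Aop_def antipode_coeff_def tau_coc_def sigma_coc_def)
  \<comment> \<open>\<open>p\<close> and \<open>x\<close> are read off from the factorization \<open>(p \<triangleleft> x)\<^sup>R (p \<succ> x)\<^sup>-\<^sup>1 = x\<^sup>-\<^sup>1 p\<^sup>R\<close>.\<close>
  have "inj_on h (bas H)"
  proof (rule inj_on_inverseI[where g = "\<lambda>(a, z). (L (a \<triangleleft> z), inv (a \<triangleright> z))"], clarify)
    fix p x
    assume "(p, x) \<in> bas H"
    then have Q: "p \<in> Q" "x \<in> F"
      by simp_all
    have "R (p \<triangleleft> x) \<otimes> inv (p \<succ> x) = inv x \<otimes> R p"
      using Q by (simp add: succ_act_eq inv_mult_group m_assoc)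
    then show "(case h (p, x) of (a, z) \<Rightarrow> (L (a \<triangleleft> z), inv (a \<triangleright> z))) = (p, x)"
      using Q rhd_lhd_parts[of "R (p \<triangleleft> x)" "inv (p \<succ> x)" "inv x" "R p"] by (simp add: h_def)
  qed
  moreover have "antipode_coeff (fst b) (snd b) \<noteq> 0" if "b \<in> bas H" for b
    using that by (auto simp: antipode_coeff_nonzero)
  ultimately have "u b = v b" if "b \<in> bas H" for b
    using monomial_map_cancel[of "bas H" h "\<lambda>b. antipode_coeff (fst b) (snd b)" u v b]
      finite_bas that eq unfolding monomial by blast
  then show "u = v"
    using elems_zero[OF u] elems_zero[OF v] by (metis ext)
qed

text \<open>From \<open>a \<otimes> z = (a \<triangleright> z) \<otimes> (a \<triangleleft>
  z)\<close>, the product \<open>L (a \<triangleleft> z) \<otimes> inv (a \<triangleright> z)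
  \<otimes> a\<close> lies in \<open>F\<close>; this identifies the coset represented by
  \<open>L a\<close>.\<close>

lemma antip_inv_lhd:
  assumes "a \<in> Q" "z \<in> F"
  shows "L (a \<triangleleft> z) \<triangleleft> inv (a \<triangleright> z) = L a"
proof -
  have "inv (a \<triangleright> z) \<otimes> (((a \<triangleright> z) \<otimes> (a \<triangleleft> z)) \<otimes> inv z) = (a \<triangleleft> z) \<otimes> inv z"
    using assms by (simp add: m_assoc)
  then have "inv (a \<triangleright> z) \<otimes> a = (a \<triangleleft> z) \<otimes> inv z"
    using assms by (simp add: rhd_lhd m_assoc)
  then have "L (a \<triangleleft> z) \<otimes> inv (a \<triangleright> z) \<otimes> a = L (a \<triangleleft> z) \<otimes> (a \<triangleleft> z) \<otimes> inv z"
    using assms by (simp add: m_assoc)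
  moreover have "L (a \<triangleleft> z) \<otimes> (a \<triangleleft> z) \<otimes> inv z \<in> F"
    using assms by simp
  ultimately have 1: "L (a \<triangleleft> z) \<otimes> inv (a \<triangleright> z) \<otimes> a \<in> F"
    by simp
  have "L (a \<triangleleft> z) \<otimes> inv (a \<triangleright> z) \<otimes> inv (L a) =
      (L (a \<triangleleft> z) \<otimes> inv (a \<triangleright> z) \<otimes> a) \<otimes> inv (L a \<otimes> a)"
    using assms by (simp add: inv_mult_group m_assoc)
  also have "\<dots> \<in> F"
    using assms by (intro F.m_closed[OF 1] F.m_inv_closed) simp
  finally show ?thesis
    using assms by (simp add: lhd_eq_iff)
qed

text \<open>The preimage is given by the inverse index map found in \<open>antip_inj\<close>; it
  remains to check that the antipode takes it back to \<open>D a z\<close>.\<close>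

lemma antip_inv_D:
  assumes "a \<in> Q" "z \<in> F"
  defines "p \<equiv> L (a \<triangleleft> z)" and "x \<equiv> inv (a \<triangleright> z)"
  shows "antip_inv H (scal k (D a z)) = scal (k * inverse (antipode_coeff p x)) (D p x)"
  unfolding antip_inv_def
proof (rule inv_into_f_eq[OF antip_inj])
  have Q: "p \<in> Q" "x \<in> F"
    using assms by simp_all
  show "scal (k * inverse (antipode_coeff p x)) (D p x) \<in> elems H"
    using Q by (intro scal_elems basis_vec_elems) simp
  have px: "p \<triangleleft> x = L a"
    unfolding p_def x_def by (rule antip_inv_lhd) fact+
  have "p \<succ> x = inv (a \<triangleleft> z) \<otimes> x \<otimes> a"
    using Q assms(1,2) by (simp add: succ_act_eq px) (simp add: p_def)
  then have "inv (p \<succ> x) = inv a \<otimes> ((a \<triangleright> z) \<otimes> (a \<triangleleft> z))"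
    using assms(1,2) by (simp add: x_def inv_mult_group m_assoc)
  then have "inv (p \<succ> x) = z"
    using assms(1,2) by (simp add: rhd_lhd)
  moreover have "antip H (scal (k * inverse (antipode_coeff p x)) (D p x)) =
      scal (k * inverse (antipode_coeff p x)) (antip H (D p x))"
    by (simp only: antip_def lincomb_scal_left)
  moreover have "k * inverse (antipode_coeff p x) * antipode_coeff p x = k"
    using Q antipode_coeff_nonzero[of p x] by simp
  ultimately show "antip H (scal (k * inverse (antipode_coeff p x)) (D p x)) = scal k (D a z)"
    using Q assms(1,2) by (simp add: antip_D px)
qed

text \<open>The \<open>F\<close>-component of the antipode of the first leg of the inverse
  associator, at \<open>p = L q\<close>, the one value of \<open>p\<close> for which the product
  with the second leg survives.\<close>

definition qL_elt :: "'a \<Rightarrow> 'a \<Rightarrow> 'a" where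
  "qL_elt q r = inv (L q \<triangleleft> \<theta> q r \<succ> inv \<theta> q r)"

definition qL_coeff :: "'a \<Rightarrow> 'a \<Rightarrow> 'k" where
  "qL_coeff q r = inverse (\<omega> (L q) q r) * inverse (\<omega> (L q) (\<theta> q r) (inv \<theta> q r))
     * antipode_coeff (L q \<triangleleft> \<theta> q r) (inv \<theta> q r)"

lemma qL_elt_F [simp]: "q \<in> Q \<Longrightarrow> r \<in> Q \<Longrightarrow> qL_elt q r \<in> F"
  by (simp add: qL_elt_def)

text \<open>\<open>alpha\<close> is the unit and drops out. The antipode of the first leg sits at
  \<open>R p\<close>, so multiplying by \<open>D q \<one>\<close> leaves only
  \<open>p = L q\<close>.\<close>

lemma q_L_H:
  "q_L H = lincomb (Q \<times> Q) (\<lambda>(q, r). qL_coeff q r) (\<lambda>(q, r). basis_vec ((q, qL_elt q r), (r, \<one>)))"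
proof -
  let ?g = "\<lambda>(a, b, c). tens (amul H (amul H (antip H (basis_vec a)) (alpha H)) (basis_vec b)) (basis_vec c)"
  have fin: "finite (bas H \<times> bas H \<times> bas H)" "finite (Q \<times> Q \<times> Q)"
    by (simp_all add: finite_Q finite_F)
  have summand: "lincomb (bas H \<times> bas H \<times> bas H) (basis_vec ((p \<triangleleft> \<theta> q r, inv \<theta> q r), (q, \<one>), (r, \<one>))) ?g =
      scal (if R p = q then antipode_coeff (p \<triangleleft> \<theta> q r) (inv \<theta> q r) else 0)
        (basis_vec ((q, inv (p \<triangleleft> \<theta> q r \<succ> inv \<theta> q r)), (r, \<one>)))"
    if "p \<in> Q" "q \<in> Q" "r \<in> Q" for p q r
    using that fin(1)
    by (subst lincomb_basis_vec)
      (auto simp: antip_D alpha_H amul_scal_left mult_unit_right mult_D tens_scal_left tens_basis_vec)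
  have "q_L H = lincomb (Q \<times> Q \<times> Q)
     (\<lambda>(p, q, r). inverse (\<omega> p q r) * inverse (\<omega> p (\<theta> q r) (inv \<theta> q r)) *
        (if R p = q then antipode_coeff (p \<triangleleft> \<theta> q r) (inv \<theta> q r) else 0))
     (\<lambda>(p, q, r). basis_vec ((q, inv (p \<triangleleft> \<theta> q r \<succ> inv \<theta> q r)), (r, \<one>)))"
    unfolding q_L_def associator_inv_H lincomb_linear
  proof (rule lincomb_cong_scal, clarify)
    fix p q r
    assume Q: "p \<in> Q" "q \<in> Q" "r \<in> Q"
    show "scal (inverse (\<omega> p q r) * inverse (\<omega> p (\<theta> q r) (inv \<theta> q r)))
       (lincomb (bas H \<times> bas H \<times> bas H)
         (basis_vec ((p \<triangleleft> \<theta> q r, inv \<theta> q r), (q, \<one>), r, \<one>)) ?g) =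
      scal (inverse (\<omega> p q r) * inverse (\<omega> p (\<theta> q r) (inv \<theta> q r)) *
        (if R p = q then antipode_coeff (p \<triangleleft> \<theta> q r) (inv \<theta> q r) else 0))
       (basis_vec ((q, inv (p \<triangleleft> \<theta> q r \<succ> inv \<theta> q r)), r, \<one>))"
      by (simp only: summand[OF Q] scal_scal)
  qed
  also have "\<dots> = lincomb (Q \<times> Q) (\<lambda>(q, r). qL_coeff q r) (\<lambda>(q, r). basis_vec ((q, qL_elt q r), (r, \<one>)))"
  proof (rule lincomb_collapse_left[where h = "\<lambda>(q, r). L q", THEN trans])
    show "finite (Q \<times> Q)" "finite Q"
      by (simp_all add: finite_Q)
  qed (auto simp: qL_coeff_def qL_elt_def intro!: lincomb_cong)
  finally show ?thesis .
qed

text \<open>The \<open>F\<close>-component of the first leg of the associator times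
  \<open>beta\<close>, at \<open>p = L q\<close>, before the inverse antipode is applied; the
  \<open>Q\<close>-component is then \<open>R q\<close>.\<close>

definition pL_elt :: "'a \<Rightarrow> 'a \<Rightarrow> 'a" where
  "pL_elt q r = inv \<theta> q (R q) \<otimes> \<theta> q r"

definition pL_coeff :: "'a \<Rightarrow> 'a \<Rightarrow> 'k" where
  "pL_coeff q r = \<omega> (L q) q r * (\<omega> (inv (R q)) (R q) (inv (R q)) * \<omega> (R q) (inv \<theta> q (R q)) (\<theta> q r)
     * inverse (antipode_coeff (L (R q \<triangleleft> pL_elt q r)) (inv (R q \<triangleright> pL_elt q r))))"

lemma pL_elt_F [simp]: "q \<in> Q \<Longrightarrow> r \<in> Q \<Longrightarrow> pL_elt q r \<in> F"
  by (simp add: pL_elt_def)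

lemma mult_beta:
  assumes "q \<in> Q" "r \<in> Q" "p \<in> Q" "x \<in> F"
  shows "amul H (D p x) (beta H) =
    scal (\<omega> (inv (R (R p))) (R (R p)) (inv (R (R p))) * \<omega> (R (R p)) (inv \<theta> (R p) (R (R p))) x)
      (D (R (R p)) (inv \<theta> (R p) (R (R p)) \<otimes> x))"
proof -
  \<comment> \<open>This locates the matching condition: the term of \<open>beta\<close> at
    \<open>a\<close> meets \<open>D p x\<close> only if \<open>L (L a) = p\<close>.\<close>
  have lhd: "a \<triangleleft> inv \<theta> (L a) a = L (L a)" if a: "a \<in> Q" for a
  proof -
    have "a \<otimes> inv \<theta> (L a) a \<otimes> inv (L (L a)) = inv (L (L a) \<otimes> L a)"
      using a by (simp add: theta_eq inv_mult_group m_assoc)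
    also have "\<dots> \<in> F"
      using a by (intro F.m_inv_closed) simp
    finally show ?thesis
      using a by (simp add: lhd_eq_iff)
  qed
  have iff: "L (L a) = p \<longleftrightarrow> a = R (R p)" if "a \<in> Q" for a
    using that assms(3) by (metis L_R R_L left_inverse(1) right_inverse(1))
  have "amul H (D p x) (beta H) = lincomb Q (\<lambda>a. \<omega> (inv a) a (inv a))
      (\<lambda>a. scal (if a = R (R p) then \<omega> a (inv \<theta> (L a) a) x else 0) (D a (inv \<theta> (L a) a \<otimes> x)))"
    \<comment> \<open>Opening the record exposes the sum that defines \<open>beta\<close>; folding
      it back restores \<open>H\<close>, so that \<open>mult_D\<close> applies.\<close>
    unfolding Aop_def quasi_hopf.simps
    unfolding Aop_def[symmetric] amul_lincomb_right using assms
    by (intro lincomb_cong) (simp_all add: mult_D lhd iff)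
  also have "\<dots> = scal (\<omega> (inv (R (R p))) (R (R p)) (inv (R (R p))) * \<omega> (R (R p)) (inv \<theta> (R p) (R (R p))) x)
      (D (R (R p)) (inv \<theta> (R p) (R (R p)) \<otimes> x))"
    unfolding lincomb_scal using assms finite_Q by (subst lincomb_single[where a = "R (R p)"]) auto
  finally show ?thesis .
qed

text \<open>By \<open>antip_inv_lhd\<close> at \<open>a = R (R p)\<close>, the inverse antipode
  meets \<open>D q \<one>\<close> exactly when \<open>R p = q\<close>, so again only
  \<open>p = L q\<close> remains.\<close>

lemma p_L_H:
  "p_L H = lincomb (Q \<times> Q) (\<lambda>(q, r). pL_coeff q r)
     (\<lambda>(q, r). basis_vec ((L (R q \<triangleleft> pL_elt q r), inv (R q \<triangleright> pL_elt q r)), (r, \<one>)))"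
proof -
  let ?g = "\<lambda>(a, b, c). tens (amul H (basis_vec b) (antip_inv H (amul H (basis_vec a) (beta H)))) (basis_vec c)"
  let ?a = "\<lambda>p. R (R p)"
  let ?u = "\<lambda>p. inv \<theta> (R p) (?a p)"
  let ?z = "\<lambda>p q r. ?u p \<otimes> \<theta> q r"
  let ?k = "\<lambda>p q r. \<omega> (inv (?a p)) (?a p) (inv (?a p)) * \<omega> (?a p) (?u p) (\<theta> q r)
      * inverse (antipode_coeff (L (?a p \<triangleleft> ?z p q r)) (inv (?a p \<triangleright> ?z p q r)))"
  let ?b = "\<lambda>p q r. basis_vec ((L (?a p \<triangleleft> ?z p q r), inv (?a p \<triangleright> ?z p q r)), (r, \<one>)) :: _ \<Rightarrow> 'k"
  have fin: "finite (bas H \<times> bas H \<times> bas H)"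
    by (simp add: finite_Q finite_F)
  have summand: "lincomb (bas H \<times> bas H \<times> bas H) (basis_vec ((p, \<theta> q r), (q, \<one>), (r, \<one>))) ?g =
      scal (if R p = q then ?k p q r else 0) (?b p q r)"
    if "p \<in> Q" "q \<in> Q" "r \<in> Q" for p q r
  proof -
    have "lincomb (bas H \<times> bas H \<times> bas H) (basis_vec ((p, \<theta> q r), (q, \<one>), (r, \<one>))) ?g =
        tens (amul H (D q \<one>) (antip_inv H (amul H (D p (\<theta> q r)) (beta H)))) (D r \<one>)"
      using that fin by (subst lincomb_basis_vec) auto
    also have "\<dots> = scal (if R p = q then ?k p q r else 0) (?b p q r)"
      using that
      by (simp add: mult_beta antip_inv_D amul_scal_right mult_D antip_inv_lhd tens_scal_left tens_basis_vec
          del: scal_scal split del: if_split) (simp add: scal_def)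
    finally show ?thesis .
  qed
  have "p_L H = lincomb (Q \<times> Q \<times> Q) (\<lambda>(p, q, r). \<omega> p q r * (if R p = q then ?k p q r else 0))
     (\<lambda>(p, q, r). ?b p q r)"
    unfolding p_L_def associator_H lincomb_linear
  proof (rule lincomb_cong_scal, clarify)
    fix p q r
    assume Q: "p \<in> Q" "q \<in> Q" "r \<in> Q"
    show "scal (\<omega> p q r) (lincomb (bas H \<times> bas H \<times> bas H)
         (basis_vec ((p, \<theta> q r), (q, \<one>), r, \<one>)) ?g) =
      scal (\<omega> p q r * (if R p = q then ?k p q r else 0)) (?b p q r)"
      by (simp only: summand[OF Q] scal_scal)
  qed
  also have "\<dots> = lincomb (Q \<times> Q) (\<lambda>(q, r). pL_coeff q r)
     (\<lambda>(q, r). basis_vec ((L (R q \<triangleleft> pL_elt q r), inv (R q \<triangleright> pL_elt q r)), (r, \<one>)))"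
  proof (rule lincomb_collapse_left[where h = "\<lambda>(q, r). L q", THEN trans])
    show "finite (Q \<times> Q)" "finite Q"
      by (simp_all add: finite_Q)
  qed (auto simp: pL_coeff_def pL_elt_def intro!: lincomb_cong)
  finally show ?thesis .
qed


section \<open>The Frobenius--Schur element\<close>

text \<open>\<open>L t \<otimes> (t \<triangleright> x) \<otimes> (t \<triangleleft> x)\<close>
  equals \<open>(L t \<otimes> t) \<otimes> x\<close>, which is in \<open>F\<close>. Hence the two
  legs of the coproduct select a term of \<open>q_L\<close> of the form
  \<open>(L r, r)\<close>.\<close>

lemma lhd_left_inverse:
  assumes "t \<in> Q" "x \<in> F"
  shows "L t \<triangleleft> (t \<triangleright> x) = L (t \<triangleleft> x)"
proof -
  let ?r = "t \<triangleleft> x"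
  have "L t \<otimes> (t \<triangleright> x) \<otimes> inv (L ?r) = L t \<otimes> ((t \<triangleright> x) \<otimes> ?r) \<otimes> inv (L ?r \<otimes> ?r)"
    using assms by (simp add: inv_mult_group m_assoc)
  also have "\<dots> = (L t \<otimes> t) \<otimes> x \<otimes> inv (L ?r \<otimes> ?r)"
    using assms by (simp add: rhd_lhd) (simp add: m_assoc)
  also have "\<dots> \<in> F"
    by (rule F.m_closed[OF F.m_closed F.m_inv_closed]) (use assms in simp_all)
  finally show ?thesis
    using assms by (simp add: lhd_eq_iff)
qed

text \<open>At \<open>q = L r\<close> the value \<open>\<theta> q r\<close> is the plain product,
  and acting with it on \<open>L q\<close> gives \<open>r\<close>; the antipode scalar is thus
  expressed by \<open>r\<close> and \<open>R r\<close>.\<close>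

lemma qL_at_left_inverse:
  assumes "r \<in> Q"
  shows "qL_elt (L r) r = r \<otimes> R r"
    and "qL_coeff (L r) r = inverse (\<omega> (L (L r)) (L r) r)
      * inverse (\<omega> (L (L r)) (L r \<otimes> r) (inv (L r \<otimes> r)))
      * (inverse (\<omega> r (R r) (inv (r \<otimes> R r))) * inverse (\<omega> (R r) (inv (r \<otimes> R r)) (r \<otimes> R r)))"
proof -
  define q p where qp: "q = L r" "p = L q"
  have Q: "q \<in> Q" "p \<in> Q" "q \<otimes> r \<in> F" "p \<otimes> q \<in> F"
    using assms by (simp_all add: qp)
  have \<theta>: "\<theta> q r = q \<otimes> r"
    using Q assms by (simp add: theta_eq)
  have "p \<otimes> (q \<otimes> r) \<otimes> inv r = p \<otimes> q"
    using Q assms by (simp add: m_assoc)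
  then have lhd: "p \<triangleleft> (q \<otimes> r) = r"
    using Q assms by (simp add: lhd_eq_iff)
  have "r \<triangleleft> inv (q \<otimes> r) = p"
    using lhd_lhd_inv(1)[OF Q(2,3)] by (simp add: lhd)
  then have succ: "r \<succ> inv (q \<otimes> r) = inv (r \<otimes> R r)"
    using Q assms F.m_inv_closed[OF Q(3)]
    by (simp add: succ_act_eq) (simp add: qp inv_mult_group m_assoc)
  show "qL_elt (L r) r = r \<otimes> R r"
    using assms by (simp add: qL_elt_def qp[symmetric] \<theta> lhd succ)
  show "qL_coeff (L r) r = inverse (\<omega> (L (L r)) (L r) r)
      * inverse (\<omega> (L (L r)) (L r \<otimes> r) (inv (L r \<otimes> r)))
      * (inverse (\<omega> r (R r) (inv (r \<otimes> R r))) * inverse (\<omega> (R r) (inv (r \<otimes> R r)) (r \<otimes> R r)))"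
    using assms by (simp add: qL_coeff_def antipode_coeff_def qp[symmetric] \<theta> lhd succ)
qed

lemma rhd_one [simp]: "t \<in> Q \<Longrightarrow> t \<triangleright> \<one> = \<one>"
  using rhd_lhd_parts[of t \<one> \<one> t] by simp

text \<open>For \<open>q = L t\<close> one has \<open>R q = t\<close>, so the two values of
  \<open>\<theta>\<close> in \<open>pL_elt\<close> cancel and the inverse antipode is evaluated at
  an idempotent, with scalar 1.\<close>

lemma pL_at_left_inverse:
  assumes "t \<in> Q"
  shows "pL_elt (L t) t = \<one>"
    and "pL_coeff (L t) t = \<omega> (L (L t)) (L t) t
      * (\<omega> (inv t) t (inv t) * \<omega> t (inv (L t \<otimes> t)) (L t \<otimes> t))"
proof -
  show elt: "pL_elt (L t) t = \<one>"
    using assms by (simp add: pL_elt_def)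
  have "L t \<succ> \<one> = \<one>"
    using assms by (simp add: succ_act_eq)
  then have "antipode_coeff (L t) \<one> = 1"
    using assms by (simp add: antipode_coeff_def)
  then show "pL_coeff (L t) t = \<omega> (L (L t)) (L t) t
      * (\<omega> (inv t) t (inv t) * \<omega> t (inv (L t \<otimes> t)) (L t \<otimes> t))"
    using assms by (simp add: pL_coeff_def elt theta_eq)
qed

text \<open>With \<open>s = L q\<close>, \<open>omega_beta\<close> cancels the coefficient of
  \<open>beta\<close> against the scalars from the inverse associator and the antipode.\<close>

lemma qL_pL_coeff:
  assumes "q \<in> Q"
  shows "qL_coeff (L (L q)) (L q) * pL_coeff (L q) q = \<omega> (L (L q)) (L q) q"
  using assms omega_beta[of "L q" q]
  by (simp add: qL_at_left_inverse pL_at_left_inverse field_simps)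

lemma nu_H_sum:
  "nu H = lincomb (F \<times> Q)
     (\<lambda>(x, t). inverse (of_nat (card F)) * \<omega> (L t) t x * qL_coeff (L (t \<triangleleft> x)) (t \<triangleleft> x)
        * \<omega> (L t) (t \<triangleright> x) (qL_elt (L (t \<triangleleft> x)) (t \<triangleleft> x)) * pL_coeff (L t) t
        * (if t \<triangleleft> x = L t then \<omega> t x ((t \<triangleright> x) \<otimes> qL_elt (L (t \<triangleleft> x)) (t \<triangleleft> x)) else 0))
     (\<lambda>(x, t). D t (x \<otimes> ((t \<triangleright> x) \<otimes> qL_elt (L (t \<triangleleft> x)) (t \<triangleleft> x))))"
proof -
  define Y where "Y = (\<lambda>x t. qL_elt (L (t \<triangleleft> x)) (t \<triangleleft> x))"
  have Y_F [simp]: "Y x t \<in> F" if "t \<in> Q" "x \<in> F" for x t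
    using that by (simp add: Y_def)
  have fin: "finite (Q \<times> Q)" "finite (F \<times> Q)" "finite (bas H \<times> bas H)"
    by (simp_all add: finite_Q finite_F)
  let ?e1 = "\<lambda>(x, t). inverse (of_nat (card F)) * \<omega> (L t) t x * qL_coeff (L (t \<triangleleft> x)) (t \<triangleleft> x)
        * \<omega> (L t) (t \<triangleright> x) (Y x t)"
  let ?b1 = "\<lambda>(x, t). basis_vec ((L t, (t \<triangleright> x) \<otimes> Y x t), (t, x)) :: _ \<Rightarrow> 'k"
  \<comment> \<open>For given \<open>x\<close> and \<open>t\<close> the two legs leave only the term
    of \<open>q_L\<close> at \<open>(L (t \<triangleleft> x), t \<triangleleft> x)\<close>.\<close>
  have 1: "amul (tensor_algebra H H) (q_L H) (Delta H (norm_integral H)) = lincomb (F \<times> Q) ?e1 ?b1"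
  proof -
    let ?c = "\<lambda>((q, r), (x, t)). qL_coeff q r * (inverse (of_nat (card F)) * \<omega> (L t) t x)
      * ((if L t \<triangleleft> (t \<triangleright> x) = q then \<omega> (L t) (t \<triangleright> x) (qL_elt q r) else 0) * (if t \<triangleleft> x = r then 1 else 0))"
    let ?v = "\<lambda>((q, r), (x, t)). basis_vec ((L t, (t \<triangleright> x) \<otimes> qL_elt q r), (t, x)) :: _ \<Rightarrow> 'k"
    have "amul (tensor_algebra H H) (q_L H) (Delta H (norm_integral H)) =
        lincomb ((Q \<times> Q) \<times> (F \<times> Q)) ?c ?v"
      unfolding q_L_H Delta_norm_integral amul_lincomb
      by (rule lincomb_cong_scal)
        (auto simp: tens_basis_vec amul_tensor_basis mult_D tens_scal cong: if_cong split del: if_split)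
    also have "\<dots> = lincomb (F \<times> Q) ?e1 ?b1"
      by (rule lincomb_collapse_left[where h = "\<lambda>(x, t). (L (t \<triangleleft> x), t \<triangleleft> x)", THEN trans])
        (use fin in \<open>auto simp: lhd_left_inverse Y_def intro!: lincomb_cong split: if_splits\<close>)
    finally show ?thesis .
  qed
  \<comment> \<open>Here only the term of \<open>p_L\<close> at \<open>(L t, t)\<close> matches. Its
    \<open>F\<close>-components are \<open>\<one>\<close>, so the basis vectors do not
    change.\<close>
  have 2: "amul (tensor_algebra H H) (lincomb (F \<times> Q) ?e1 ?b1) (p_L H) =
      lincomb (F \<times> Q) (\<lambda>(x, t). ?e1 (x, t) * pL_coeff (L t) t) ?b1"
  proof -
    let ?P = "\<lambda>q r. L (R q \<triangleleft> pL_elt q r)"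
    let ?X = "\<lambda>q r. inv (R q \<triangleright> pL_elt q r)"
    let ?c = "\<lambda>((x, t), (q, r)). ?e1 (x, t) * pL_coeff q r
      * ((if q = L t then \<omega> (?P q r) (?X q r) ((t \<triangleright> x) \<otimes> Y x t) else 0) * (if r = t then 1 else 0))"
    let ?v = "\<lambda>((x, t), (q, r)). basis_vec ((?P q r, ?X q r \<otimes> ((t \<triangleright> x) \<otimes> Y x t)), (r, x)) :: _ \<Rightarrow> 'k"
    have "amul (tensor_algebra H H) (lincomb (F \<times> Q) ?e1 ?b1) (p_L H) =
        lincomb ((F \<times> Q) \<times> (Q \<times> Q)) ?c ?v"
      unfolding p_L_H amul_lincomb
      by (rule lincomb_cong_scal)
        (auto simp: amul_tensor_basis mult_D tens_scal tens_basis_vec antip_inv_lhd cong: if_cong split del: if_split)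
    also have "\<dots> = lincomb (F \<times> Q) (\<lambda>(x, t). ?e1 (x, t) * pL_coeff (L t) t) ?b1"
      by (rule lincomb_collapse_right[where h = "\<lambda>(x, t). (L t, t)", THEN trans])
        (use fin in \<open>auto simp: pL_at_left_inverse intro!: lincomb_cong split: if_splits\<close>)
    finally show ?thesis .
  qed
  \<comment> \<open>Multiplying the two legs together imposes the condition
    \<open>t \<triangleleft> x = L t\<close>.\<close>
  have "nu H = lincomb (F \<times> Q) (\<lambda>(x, t). ?e1 (x, t) * pL_coeff (L t) t)
      (\<lambda>(x, t). amul H (D (L t) ((t \<triangleright> x) \<otimes> Y x t)) (D t x))"
    unfolding nu_def mult_map_def 1 2 lincomb_linear
    by (intro lincomb_cong) (auto simp: lincomb_basis_vec fin(3)[simplified] amul_basis finite_bas[simplified])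
  also have "\<dots> = lincomb (F \<times> Q)
     (\<lambda>(x, t). ?e1 (x, t) * pL_coeff (L t) t * (if t \<triangleleft> x = L t then \<omega> t x ((t \<triangleright> x) \<otimes> Y x t) else 0))
     (\<lambda>(x, t). D t (x \<otimes> ((t \<triangleright> x) \<otimes> Y x t)))"
    by (rule lincomb_cong_scal) (auto simp: mult_D split del: if_split)
  finally show ?thesis
    unfolding Y_def by simp
qed

lemma square_eq:
  assumes "q \<in> Q" "x \<in> F"
  shows "(x \<otimes> q) [^] (2::nat) = x \<otimes> ((q \<triangleright> x) \<otimes> ((q \<triangleleft> x) \<otimes> q))"
proof -
  have "(q \<triangleright> x) \<otimes> ((q \<triangleleft> x) \<otimes> q) = q \<otimes> x \<otimes> q"
    using assms by (simp add: m_assoc[symmetric] rhd_lhd)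
  then show ?thesis
    using assms by (simp add: numeral_2_eq_2 m_assoc)
qed

text \<open>On the support \<open>q \<triangleleft> x = L q\<close>, so \<open>qL_elt\<close>
  becomes \<open>L q \<otimes> q\<close> and \<open>square_eq\<close> recognizes the square.
  \<open>prod.swap\<close> reconciles the index order \<open>(x, t)\<close> with
  \<open>(q, x)\<close>.\<close>

lemma nu_H:
  "nu H = lincomb {(q, x). q \<in> Q \<and> x \<in> F \<and> dot G F Q (q \<triangleleft> x) q = \<one>}
     (\<lambda>(q, x). inverse (of_nat (card F)) * (\<omega> (q \<triangleleft> x) q x * \<omega> q x (q \<triangleright> x)
        * \<omega> (L (q \<triangleleft> x)) (q \<triangleleft> x) q * \<omega> q (x \<otimes> (q \<triangleright> x)) ((q \<triangleleft> x) \<otimes> q)))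
     (\<lambda>(q, x). D q ((x \<otimes> q) [^] (2::nat)))" (is "_ = lincomb ?J ?c ?v")
  unfolding nu_H_sum
proof (rule lincomb_restrict[where f = prod.swap], goal_cases)
  case 1
  show ?case
    by (simp add: finite_F finite_Q)
next
  case (4 i)
  then obtain x t where i: "i = (x, t)" "x \<in> F" "t \<in> Q" and "i \<notin> prod.swap ` ?J"
    by auto
  moreover have "i \<in> prod.swap ` ?J" if "t \<triangleleft> x = L t"
    using i that by (auto simp: dot_one_iff image_iff)
  ultimately show ?case
    by auto
next
  case (5 j)
  obtain q x where j: "j = (q, x)"
    by fastforce
  then have Q: "q \<in> Q" "x \<in> F" and "(q \<triangleleft> x) \<otimes> q \<in> F"
    using 5 by (auto simp: dot_one_iff)
  then have s: "q \<triangleleft> x = L q"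
    using left_inverse(3)[of q "q \<triangleleft> x"] by simp
  \<comment> \<open>The cocycle identity at
    \<open>q, x, q \<triangleright> x, L q \<otimes> q\<close>, with the first argument
    \<open>q \<otimes> x\<close> replaced by \<open>q \<triangleleft> x = L q\<close>.\<close>
  have "\<omega> (L q) (q \<triangleright> x) (L q \<otimes> q) * \<omega> q x ((q \<triangleright> x) \<otimes> (L q \<otimes> q)) =
      \<omega> q x (q \<triangleright> x) * \<omega> q (x \<otimes> (q \<triangleright> x)) (L q \<otimes> q)"
    using omega_cocycle[of q x "q \<triangleright> x" "L q \<otimes> q"] omega_lhd[of q x "q \<triangleright> x" "L q \<otimes> q"] Q
    by (simp add: omega_F_left s)
  then show ?case
    using qL_pL_coeff[OF Q(1)] Q by (simp add: j s qL_at_left_inverse(1) mult_ac)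
next
  case (6 j)
  then show ?case
    by (auto simp: dot_one_iff square_eq qL_at_left_inverse(1) right_inverse(3))
qed (auto simp: inj_on_def)

lemma square_F:
  assumes "q \<in> Q" "x \<in> F" "dot G F Q (q \<triangleleft> x) q = \<one>"
  shows "(x \<otimes> q) [^] (2::nat) \<in> F" "(q \<triangleleft> x) \<otimes> q \<in> F"
  using assms by (auto simp: dot_one_iff square_eq)

lemma FS_indicator_H:
  assumes "representation H \<rho>"
  shows "FS_indicator H (character \<rho>) = inverse (of_nat (card F)) *
    (\<Sum>(q, x)\<in>{(q, x). q \<in> Q \<and> x \<in> F \<and> dot G F Q (q \<triangleleft> x) q = \<one>}.
       \<omega> (q \<triangleleft> x) q x * \<omega> q x (q \<triangleright> x) * \<omega> (L (q \<triangleleft> x)) (q \<triangleleft> x) q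
         * \<omega> q (x \<otimes> (q \<triangleright> x)) ((q \<triangleleft> x) \<otimes> q) * character \<rho> (D q ((x \<otimes> q) [^] (2::nat))))"
    (is "_ = _ * sum _ ?J")
proof -
  have "finite ?J"
    by (rule finite_subset[of _ "Q \<times> F"]) (auto simp: finite_Q finite_F)
  then have "FS_indicator H (character \<rho>) = (\<Sum>i\<in>?J. (case i of (q, x) \<Rightarrow> inverse (of_nat (card F)) *
      (\<omega> (q \<triangleleft> x) q x * \<omega> q x (q \<triangleright> x) * \<omega> (L (q \<triangleleft> x)) (q \<triangleleft> x) q
         * \<omega> q (x \<otimes> (q \<triangleright> x)) ((q \<triangleleft> x) \<otimes> q))) *
      character \<rho> (case i of (q, x) \<Rightarrow> D q ((x \<otimes> q) [^] (2::nat))))"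
    unfolding FS_indicator_def nu_H
    by (intro representation_lincomb[OF assms]) (auto intro!: basis_vec_elems simp: square_F)
  then show ?thesis
    by (simp add: sum_distrib_left case_prod_beta mult.assoc)
qed

end

theorem corollary5p4:
  fixes G :: "('g, 'm) monoid_scheme" (structure)
    and F Q :: "'g set"
    and \<omega> :: "'g \<Rightarrow> 'g \<Rightarrow> 'g \<Rightarrow> 'k::{alg_closed_field, field_char_0}"
    and \<rho> :: "('g \<times> 'g \<Rightarrow> 'k) \<Rightarrow> 'k ^ 'n::finite ^ 'n"
    and ch :: "('g \<times> 'g \<Rightarrow> 'k) \<Rightarrow> 'k"
  assumes "group G" and "finite (carrier G)" and "subgroup F G"
    and "two_sided_transversal G F Q" and "\<one> \<in> Q"
    and "normalized_3_cocycle G \<omega>"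
    and "\<forall>x\<in>F. \<forall>a\<in>carrier G. \<forall>b\<in>carrier G. \<omega> x a b = 1"
    and "\<forall>a\<in>carrier G. \<forall>x\<in>F. \<forall>q\<in>Q. \<omega> a x q = 1"
    and "irreducible_representation (Aop G F Q \<omega>) \<rho>"
    and "ch = character \<rho>"
  shows "FS_indicator (Aop G F Q \<omega>) ch =
           inverse (of_nat (card F)) *
           (\<Sum>(q, x)\<in>{(q, x). q \<in> Q \<and> x \<in> F \<and> dot G F Q (lhd G F Q q x) q = \<one>}.
              \<omega> (x \<otimes> q) (x \<otimes> q) (x \<otimes> q) * ch (basis_vec (q, (x \<otimes> q) [^] (2::nat))))
       \<and> FS_indicator (Aop G F Q \<omega>) ch =
           inverse (of_nat (card F)) *
           (\<Sum>(q, x)\<in>{(q, x). q \<in> Q \<and> x \<in> F \<and> dot G F Q (lhd G F Q q x) q = \<one>}.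
              tau_coc \<omega> x (lhd G F Q q x) q
              * sigma_coc \<omega> q x (rhd G F Q q x)
              * \<omega> (linv G F Q (lhd G F Q q x)) (lhd G F Q q x) q
              * sigma_coc \<omega> q (x \<otimes> rhd G F Q q x) (lhd G F Q q x \<otimes> q)
              * ch (basis_vec (q, (x \<otimes> q) [^] (2::nat))))
       \<and> (\<forall>q\<in>Q. \<forall>x\<in>F. dot G F Q (lhd G F Q q x) q = \<one> \<longrightarrow>
              (x \<otimes> q) [^] (2::nat) \<in> F \<and> lhd G F Q q x \<otimes> q \<in> F)"
proof -
  interpret transversal_cocycle G F Q \<omega>
    using assms(1-8) by (auto simp: transversal_cocycle_def transversal_cocycle_axioms_def)
  let ?J = "{(q, x). q \<in> Q \<and> x \<in> F \<and> dot G F Q (lhd G F Q q x) q = \<one>}"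
  have rep: "representation (Aop G F Q \<omega>) \<rho>"
    using assms(9) by (simp add: irreducible_representation_def)
  \<comment> \<open>The expanded formula is obtained first; the compact one follows from it term by
    term through \<open>omega_square\<close>.\<close>
  have FS: "FS_indicator (Aop G F Q \<omega>) ch = inverse (of_nat (card F)) *
      (\<Sum>(q, x)\<in>?J. tau_coc \<omega> x (lhd G F Q q x) q
              * sigma_coc \<omega> q x (rhd G F Q q x)
              * \<omega> (linv G F Q (lhd G F Q q x)) (lhd G F Q q x) q
              * sigma_coc \<omega> q (x \<otimes> rhd G F Q q x) (lhd G F Q q x \<otimes> q)
              * ch (basis_vec (q, (x \<otimes> q) [^] (2::nat))))"
    unfolding assms(10) tau_coc_def sigma_coc_def by (rule FS_indicator_H[OF rep])
  moreover have "(\<Sum>(q, x)\<in>?J. tau_coc \<omega> x (lhd G F Q q x) q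
              * sigma_coc \<omega> q x (rhd G F Q q x)
              * \<omega> (linv G F Q (lhd G F Q q x)) (lhd G F Q q x) q
              * sigma_coc \<omega> q (x \<otimes> rhd G F Q q x) (lhd G F Q q x \<otimes> q)
              * ch (basis_vec (q, (x \<otimes> q) [^] (2::nat)))) =
      (\<Sum>(q, x)\<in>?J. \<omega> (x \<otimes> q) (x \<otimes> q) (x \<otimes> q) * ch (basis_vec (q, (x \<otimes> q) [^] (2::nat))))"
    by (intro sum.cong refl) (auto simp: omega_square square_F tau_coc_def sigma_coc_def)
  ultimately show ?thesis
    using square_F by simp
qed

end
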